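(* Let $n\ge 1$ and let $(\mathcal O,\mathcal C)$, $\mathcal O,\mathcal C\subseteq[n]$, be an opener-closer configuration. Then there exists a non-nesting set partition $\mathcal B$ of type $D_n$ with $\operatorname{op}(\mathcal B)=\mathcal O$ and $\operatorname{cl}(\mathcal B)=\mathcal C$ if and only if $$|\mathcal O|-|\mathcal C|\text{ is even}\quad\text{or}\quad n\in\mathcal O\cap\mathcal C.$$ Furthermore, if both of these conditions hold (that is, $|\mathcal O|-|\mathcal C|$ is even and $n\in\mathcal O\cap\mathcal C$), there exist exactly two non-nesting set partitions of type $D_n$ having this opener-closer configuration; otherwise (if exactly one of the two conditions holds) it is unique.
   Context: Let $[n]=\{1,\dots,n\}$ (with $[0]=\emptyset$) and $[\pm n]=\{1,\dots,n,-1,\dots,-n\}$. A set partition of type $C_n$ is a set partition $\mathcal B$ of $[\pm n]$ such that $B\in\mathcal B\Leftrightarrow -B\in\mathcal B$ and such that there is at most one block $B_0$ (the zero block) with $B_0=-B_0$. A set partition of type $D_n$ is a set partition of type $C_n$ whose zero block, if present, does not consist of a single pair $\{i,-i\}$. An opener-closer configuration is a pair $(\mathcal O,\mathcal C)$ of subsets of $[n]$ with $|\mathcal O\cap[k]|\ge|\mathcal C\cap[k+1]|$ for all $k\in\{0,1,\dots,n-1\}$ (it is not required that $|\mathcal O|=|\mathcal C|$). The nesting order is $1<2<\dots<n<-n<\dots<-2<-1$. The arcs of $\mathcal B$ are the pairs $(i,j)$ where $i$ and $j$ are consecutive elements of a block with respect to the nesting order, $i$ preceding $j$. Two arcs nest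 if they can be written $(a,b)$, $(a',b')$ with $a<a'<b'<b$ in the nesting order. The openers $\operatorname{op}(\mathcal B)$ are the positive elements not maximal in their block, and the closers $\operatorname{cl}(\mathcal B)$ are the positive elements not minimal in their block, both with respect to the nesting order. A set partition $\mathcal B$ of type $D_n$ is called non-nesting if (i) whenever $(i,-i)$ is an arc of $\mathcal B$ then $i=n$; and if no two arcs of $\mathcal B$ nest, with the following exceptions: (ii) arcs $(i,-n)$ and $(j,n)$ with $0<i<j<n$ are allowed to nest, and likewise their negatives $(n,-i)$ and $(-n,-j)$; (iii) arcs $(i,-j)$ and $(n,-n)$ are allowed to nest if $k<i,j<n$, where $k>0$ is such that $(k,n)$ is an arc of $\mathcal B$ (such $k$ exists whenever $(n,-n)$ is an arc, by the definition of set partitions of type $D_n$). *)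

theory Defs
  imports Main "HOL-Library.Disjoint_Sets"
begin

definition pm_interval :: "nat \<Rightarrow> int set" where
  "pm_interval n = {1..int n} \<union> {- int n..-1}"

definition set_partition_C :: "nat \<Rightarrow> int set set \<Rightarrow> bool" where
  "set_partition_C n P \<longleftrightarrow>
     partition_on (pm_interval n) P \<and>
     (\<forall>B. B \<in> P \<longleftrightarrow> uminus ` B \<in> P) \<and>
     (\<forall>B\<in>P. \<forall>B'\<in>P. B = uminus ` B \<and> B' = uminus ` B' \<longrightarrow> B = B')"

definition set_partition_D :: "nat \<Rightarrow> int set set \<Rightarrow> bool" where
  "set_partition_D n P \<longleftrightarrow>
     set_partition_C n P \<and>
     (\<forall>B\<in>P. B = uminus ` B \<longrightarrow> \<not> (\<exists>i. B = {i, - i}))"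

definition opener_closer_config :: "nat \<Rightarrow> int set \<Rightarrow> int set \<Rightarrow> bool" where
  "opener_closer_config n Op Cl \<longleftrightarrow>
     Op \<subseteq> {1..int n} \<and> Cl \<subseteq> {1..int n} \<and>
     (\<forall>k<n. card (Op \<inter> {1..int k}) \<ge> card (Cl \<inter> {1..int (k + 1)}))"

(* The order 1 < 2 < ... < n < -n < ... < -2 < -1 on nonzero integers: positive elements
   precede negative ones, and elements of equal sign are compared as usual. This does not
   depend on n. *)
definition nest_less :: "int \<Rightarrow> int \<Rightarrow> bool" where
  "nest_less a b \<longleftrightarrow> (0 < a \<and> b < 0) \<or> (0 < a \<and> 0 < b \<and> a < b) \<or> (a < 0 \<and> b < 0 \<and> a < b)"

definition arcs :: "int set set \<Rightarrow> (int \<times> int) set" where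
  "arcs P = {(i, j). \<exists>B\<in>P. i \<in> B \<and> j \<in> B \<and> nest_less i j \<and>
                       \<not> (\<exists>k\<in>B. nest_less i k \<and> nest_less k j)}"

definition openers :: "int set set \<Rightarrow> int set" where
  "openers P = {i. 0 < i \<and> (\<exists>B\<in>P. i \<in> B \<and> (\<exists>j\<in>B. nest_less i j))}"

definition closers :: "int set set \<Rightarrow> int set" where
  "closers P = {i. 0 < i \<and> (\<exists>B\<in>P. i \<in> B \<and> (\<exists>j\<in>B. nest_less j i))}"

(* nests p q: the arc q is nested inside the arc p. *)
definition nests :: "int \<times> int \<Rightarrow> int \<times> int \<Rightarrow> bool" where
  "nests p q \<longleftrightarrow> nest_less (fst p) (fst q) \<and> nest_less (fst q) (snd q) \<and> nest_less (snd q) (snd p)"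

(* In each disjunct p is the outer and q the inner arc. The second disjunct is the
   negative of the first. *)
definition nesting_exception :: "nat \<Rightarrow> int set set \<Rightarrow> int \<times> int \<Rightarrow> int \<times> int \<Rightarrow> bool" where
  "nesting_exception n P p q \<longleftrightarrow>
     (\<exists>i j. 0 < i \<and> i < j \<and> j < int n \<and> p = (i, - int n) \<and> q = (j, int n)) \<or>
     (\<exists>i j. 0 < i \<and> i < j \<and> j < int n \<and> p = (int n, - i) \<and> q = (- int n, - j)) \<or>
     (\<exists>i j k. 0 < k \<and> (k, int n) \<in> arcs P \<and> k < i \<and> i < int n \<and> k < j \<and> j < int n \<and>
              p = (i, - j) \<and> q = (int n, - int n))"

definition nonnesting_D :: "nat \<Rightarrow> int set set \<Rightarrow> bool" where
  "nonnesting_D n P \<longleftrightarrow>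
     set_partition_D n P \<and>
     (\<forall>i. (i, - i) \<in> arcs P \<longrightarrow> i = int n) \<and>
     (\<forall>p\<in>arcs P. \<forall>q\<in>arcs P. nests p q \<longrightarrow> nesting_exception n P p q)"

end

theory Submission
  imports Defs
begin

text \<open>A set partition can be recovered from its arcs, so the non-nesting partitions may be replaced by
  their arc sets: sets of pairs that increase in the nesting order, are closed under negation and
  give every element at most one successor and one predecessor (\<open>bij_betw_arcs\<close>).

  Such a set consists of the arcs between positive elements, their negatives, and the arcs
  \<open>(i, - j)\<close> from a positive to a negative element. Let \<open>F\<close> be the set of starting points of the
  first kind, let \<open>Z\<close> be \<open>{n}\<close> or empty according to whether \<open>(n, - n)\<close> is an arc, and let
  \<open>T = Op - F - Z\<close>. The absence of nestings makes the bijections \<open>F \<rightarrow> Cl\<close> and \<open>T \<rightarrow> - T\<close> given by the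
  arcs increasing, and an increasing bijection between two finite sets of integers is unique. The
  arc set is therefore determined by \<open>F\<close> and \<open>Z\<close>. The bijection \<open>T \<rightarrow> - T\<close> reverses \<open>T\<close>; if \<open>T\<close> had
  an odd number of elements, its middle element \<open>i\<close> would yield an arc \<open>(i, - i)\<close>, which for
  \<open>i \<noteq> n\<close> is forbidden and for \<open>i = n\<close> is accounted for by \<open>Z\<close>. So \<open>T\<close> is even, which is where the
  parity of \<open>|Op| - |Cl|\<close> comes from.

  It remains to find the possible \<open>F\<close>. If some opener \<open>s\<close> outside \<open>F\<close> precedes some \<open>x\<close> in \<open>F\<close>, then
  the arc starting at \<open>s\<close> nests the one starting at \<open>x\<close>, which is tolerated only for the arcs
  \<open>(s, - n)\<close> and \<open>(x, n)\<close>. Hence there is at most one such pair. If there is none, \<open>F\<close> is the initial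
  segment of \<open>Op\<close> of size \<open>|Cl|\<close>, and the parity decides whether \<open>Z\<close> is empty. This gives one solution
  in the even case and one in the odd case with \<open>n \<in> Op \<inter> Cl\<close>. If there is such a pair, then \<open>F\<close>
  arises from the initial segment by exchanging its last element for the next opener, \<open>n\<close> is both an
  opener and a closer, and \<open>Z\<close> is empty; this gives a further solution in the even case with
  \<open>n \<in> Op \<inter> Cl\<close> (\<open>admissible_iff\<close>). Conversely, all of these choices define non-nesting arc sets
  (\<open>arc_system_nonnesting_arcs\<close>); the inequalities in the definition of an opener-closer configuration
  ensure that the closers lie to the right of the openers matched with them.\<close>

section \<open>Partitions and their arcs\<close>

lemma nest_less_irrefl: "\<not> nest_less a a"
  by (auto simp: nest_less_def)

lemma nest_less_trans: "nest_less a b \<Longrightarrow> nest_less b c \<Longrightarrow> nest_less a c"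
  by (auto simp: nest_less_def)

lemma nest_less_total: "a \<noteq> 0 \<Longrightarrow> b \<noteq> 0 \<Longrightarrow> a \<noteq> b \<Longrightarrow> nest_less a b \<or> nest_less b a"
  by (auto simp: nest_less_def)

lemma nest_less_uminus: "nest_less (- b) (- a) \<longleftrightarrow> nest_less a b"
  by (auto simp: nest_less_def)

lemma mem_pm_interval: "x \<in> pm_interval n \<longleftrightarrow> x \<noteq> 0 \<and> \<bar>x\<bar> \<le> int n"
  by (auto simp: pm_interval_def)

lemma finite_pm_interval: "finite (pm_interval n)"
  by (simp add: pm_interval_def)

text \<open>Since every vertex of a matching has at most one successor and at most one predecessor, two
  vertices lie in the same component iff one of them can be reached from the other along the arcs.\<close>

definition same_path :: "nat \<Rightarrow> (int \<times> int) set \<Rightarrow> (int \<times> int) set" where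
  "same_path n A =
     {(x, y). x \<in> pm_interval n \<and> y \<in> pm_interval n \<and> ((x, y) \<in> A\<^sup>* \<or> (y, x) \<in> A\<^sup>*)}"

definition path_blocks :: "nat \<Rightarrow> (int \<times> int) set \<Rightarrow> int set set" where
  "path_blocks n A = pm_interval n // same_path n A"

definition symmetric_matching :: "nat \<Rightarrow> (int \<times> int) set \<Rightarrow> bool" where
  "symmetric_matching n A \<longleftrightarrow>
     A \<subseteq> pm_interval n \<times> pm_interval n \<and>
     (\<forall>i j. (i, j) \<in> A \<longrightarrow> nest_less i j) \<and>
     single_valued A \<and> single_valued (A\<inverse>) \<and>
     (\<forall>i j. (i, j) \<in> A \<longrightarrow> (- j, - i) \<in> A)"

text \<open>The condition \<open>nesting_exception\<close> depends on the partition only through its arcs; stating it for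
  a set of arcs makes it possible to speak of non-nesting sets of arcs before a partition with these
  arcs has been constructed.\<close>

definition exceptional :: "nat \<Rightarrow> (int \<times> int) set \<Rightarrow> int \<times> int \<Rightarrow> int \<times> int \<Rightarrow> bool" where
  "exceptional n A p q \<longleftrightarrow>
     (\<exists>i j. 0 < i \<and> i < j \<and> j < int n \<and> p = (i, - int n) \<and> q = (j, int n)) \<or>
     (\<exists>i j. 0 < i \<and> i < j \<and> j < int n \<and> p = (int n, - i) \<and> q = (- int n, - j)) \<or>
     (\<exists>i j k. 0 < k \<and> (k, int n) \<in> A \<and> k < i \<and> i < int n \<and> k < j \<and> j < int n \<and>
              p = (i, - j) \<and> q = (int n, - int n))"

lemma nesting_exception_arcs: "nesting_exception n P = exceptional n (arcs P)"
  by (intro ext) (simp only: nesting_exception_def exceptional_def)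

definition nonnesting_arcs :: "nat \<Rightarrow> (int \<times> int) set \<Rightarrow> bool" where
  "nonnesting_arcs n A \<longleftrightarrow>
     symmetric_matching n A \<and>
     (\<forall>i. (i, - i) \<in> A \<longrightarrow> i = int n \<and> (\<exists>k. (k, int n) \<in> A)) \<and>
     (\<forall>p\<in>A. \<forall>q\<in>A. nests p q \<longrightarrow> exceptional n A p q)"

lemma arcsE:
  assumes "(i, j) \<in> arcs P"
  obtains B where "B \<in> P" "i \<in> B" "j \<in> B" "nest_less i j"
    "\<not> (\<exists>k\<in>B. nest_less i k \<and> nest_less k j)"
  using assms by (auto simp: arcs_def)

lemma arcs_nest_less: "(i, j) \<in> arcs P \<Longrightarrow> nest_less i j"
  by (auto simp: arcs_def)

lemma block_subset: "partition_on (pm_interval n) P \<Longrightarrow> B \<in> P \<Longrightarrow> B \<subseteq> pm_interval n"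
  by (auto simp: partition_on_def)

lemma block_eq:
  "partition_on (pm_interval n) P \<Longrightarrow> B \<in> P \<Longrightarrow> B' \<in> P \<Longrightarrow> x \<in> B \<Longrightarrow> x \<in> B' \<Longrightarrow> B = B'"
  unfolding partition_on_def disjoint_def by blast

lemma block_nonzero: "partition_on (pm_interval n) P \<Longrightarrow> B \<in> P \<Longrightarrow> x \<in> B \<Longrightarrow> x \<noteq> 0"
  using block_subset mem_pm_interval by blast

text \<open>An element of a block that lies strictly between \<open>x\<close> and \<open>y\<close> splits the problem into two
  problems with fewer elements in between; if there is none, \<open>(x, y)\<close> is an arc itself.\<close>

lemma trancl_arcs_if_nest_less:
  assumes P: "partition_on (pm_interval n) P" and B: "B \<in> P"
    and "x \<in> B" "y \<in> B" "nest_less x y"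
  shows "(x, y) \<in> (arcs P)\<^sup>+"
proof -
  have fin: "finite B"
    using block_subset[OF P B] finite_pm_interval finite_subset by blast
  \<comment> \<open>the elements of the block strictly between two given ones, whose number is the induction measure\<close>
  define btw where "btw x y = {k \<in> B. nest_less x k \<and> nest_less k y}" for x y
  have fb: "finite (btw x y)" for x y unfolding btw_def using fin by simp
  show ?thesis using assms(3-5)
  proof (induction "card (btw x y)" arbitrary: x y rule: less_induct)
    case less
    show ?case
    proof (cases "btw x y = {}")
      case True
      then have "(x, y) \<in> arcs P"
        using less.prems B unfolding arcs_def btw_def by blast
      then show ?thesis by blast
    next
      case False
      then obtain k where k: "k \<in> B" "nest_less x k" "nest_less k y"
        unfolding btw_def by blast
      have "btw x k \<subset> btw x y" "btw k y \<subset> btw x y"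
        unfolding btw_def using k nest_less_trans nest_less_irrefl by blast+
      then have "card (btw x k) < card (btw x y)" "card (btw k y) < card (btw x y)"
        using fb psubset_card_mono by blast+
      then have "(x, k) \<in> (arcs P)\<^sup>+" "(k, y) \<in> (arcs P)\<^sup>+"
        using less.hyps less.prems k by blast+
      then show ?thesis by (rule trancl_trans)
    qed
  qed
qed

lemma rtrancl_arcs_same_block:
  assumes P: "partition_on (pm_interval n) P" and B: "B \<in> P" and x: "x \<in> B"
    and "(x, y) \<in> (arcs P)\<^sup>*"
  shows "y \<in> B"
  using assms(4)
proof (induction rule: rtrancl_induct)
  case (step y z)
  from step.hyps(2) obtain B' where B': "B' \<in> P" "y \<in> B'" "z \<in> B'"
    unfolding arcs_def by blast
  have "B' = B" using block_eq[OF P B'(1) B B'(2) step.IH] .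
  then show ?case using B' by simp
qed (rule x)

text \<open>Arcs never leave a block, and any two elements of a block are joined by a path of arcs.\<close>

lemma path_blocks_arcs:
  assumes P: "partition_on (pm_interval n) P"
  shows "path_blocks n (arcs P) = P"
proof -
  have "same_path n (arcs P) = {(x, y). \<exists>B\<in>P. x \<in> B \<and> y \<in> B}"
  proof (rule set_eqI, clarify)
    fix x y
    have "(x, y) \<in> same_path n (arcs P)" if B: "B \<in> P" "x \<in> B" "y \<in> B" for B
    proof -
      have nz: "x \<noteq> 0" "y \<noteq> 0" using block_nonzero[OF P B(1)] B by auto
      have "x \<in> pm_interval n" "y \<in> pm_interval n"
        using block_subset[OF P B(1)] B by auto
      moreover have "x = y \<or> (x, y) \<in> (arcs P)\<^sup>+ \<or> (y, x) \<in> (arcs P)\<^sup>+"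
        using trancl_arcs_if_nest_less[OF P B(1)] B nest_less_total[OF nz] by blast
      ultimately show ?thesis
        unfolding same_path_def by (auto intro: trancl_into_rtrancl)
    qed
    moreover have "\<exists>B\<in>P. x \<in> B \<and> y \<in> B" if "(x, y) \<in> same_path n (arcs P)"
    proof -
      have xy: "x \<in> pm_interval n" "y \<in> pm_interval n"
        and *: "(x, y) \<in> (arcs P)\<^sup>* \<or> (y, x) \<in> (arcs P)\<^sup>*"
        using that unfolding same_path_def by auto
      obtain B B' where "B \<in> P" "x \<in> B" "B' \<in> P" "y \<in> B'"
        using xy P unfolding partition_on_def by blast
      then show ?thesis using * rtrancl_arcs_same_block[OF P] by blast
    qed
    ultimately show "(x, y) \<in> same_path n (arcs P) \<longleftrightarrow>
        (x, y) \<in> {(x, y). \<exists>B\<in>P. x \<in> B \<and> y \<in> B}" by blast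
  qed
  then show ?thesis
    unfolding path_blocks_def using partition_on_eq_quotient[OF P] by simp
qed

lemma openers_eq_Domain_arcs:
  assumes P: "partition_on (pm_interval n) P"
  shows "openers P = {i \<in> Domain (arcs P). 0 < i}"
proof -
  have "i \<in> Domain (arcs P)" if "B \<in> P" "i \<in> B" "j \<in> B" "nest_less i j" for B i j
    using trancl_arcs_if_nest_less[OF P that] tranclD by fastforce
  then show ?thesis unfolding openers_def by (auto simp: arcs_def)
qed

lemma closers_eq_Range_arcs:
  assumes P: "partition_on (pm_interval n) P"
  shows "closers P = {i \<in> Range (arcs P). 0 < i}"
proof -
  have "i \<in> Range (arcs P)" if "B \<in> P" "j \<in> B" "i \<in> B" "nest_less j i" for B i j
    using trancl_arcs_if_nest_less[OF P that] tranclD2 by fastforce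
  then show ?thesis unfolding closers_def by (auto simp: arcs_def)
qed

lemma symmetric_matching_arcs:
  assumes P: "partition_on (pm_interval n) P" and sym: "\<And>B. B \<in> P \<Longrightarrow> uminus ` B \<in> P"
  shows "symmetric_matching n (arcs P)"
  unfolding symmetric_matching_def
proof (intro conjI allI impI)
  show "arcs P \<subseteq> pm_interval n \<times> pm_interval n"
    using block_subset[OF P] unfolding arcs_def by blast
  show "nest_less i j" if "(i, j) \<in> arcs P" for i j using arcs_nest_less[OF that] .
  show "single_valued (arcs P)"
  proof (rule single_valuedI)
    fix x y z assume "(x, y) \<in> arcs P" "(x, z) \<in> arcs P"
    then obtain B B' where B: "B \<in> P" "x \<in> B" "y \<in> B" "nest_less x y"
        "\<not> (\<exists>k\<in>B. nest_less x k \<and> nest_less k y)"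
      and B': "B' \<in> P" "x \<in> B'" "z \<in> B'" "nest_less x z"
        "\<not> (\<exists>k\<in>B'. nest_less x k \<and> nest_less k z)"
      unfolding arcs_def by blast
    have "B' = B" using block_eq[OF P] B B' by blast
    then show "y = z"
      using B B' nest_less_total block_nonzero[OF P B(1)] by metis
  qed
  show "single_valued ((arcs P)\<inverse>)"
  proof (rule single_valuedI)
    fix x y z assume "(x, y) \<in> (arcs P)\<inverse>" "(x, z) \<in> (arcs P)\<inverse>"
    then obtain B B' where B: "B \<in> P" "x \<in> B" "y \<in> B" "nest_less y x"
        "\<not> (\<exists>k\<in>B. nest_less y k \<and> nest_less k x)"
      and B': "B' \<in> P" "x \<in> B'" "z \<in> B'" "nest_less z x"
        "\<not> (\<exists>k\<in>B'. nest_less z k \<and> nest_less k x)"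
      unfolding arcs_def by blast
    have "B' = B" using block_eq[OF P] B B' by blast
    then show "y = z"
      using B B' nest_less_total block_nonzero[OF P B(1)] by metis
  qed
  show "(- j, - i) \<in> arcs P" if arc: "(i, j) \<in> arcs P" for i j
  proof -
    obtain B where B: "B \<in> P" "i \<in> B" "j \<in> B" "nest_less i j"
        "\<not> (\<exists>k\<in>B. nest_less i k \<and> nest_less k j)"
      using arc by (rule arcsE)
    have "\<not> (\<exists>k\<in>uminus ` B. nest_less (- j) k \<and> nest_less k (- i))"
      using B(5) by (auto simp: nest_less_uminus)
    moreover have "uminus ` B \<in> P" "- j \<in> uminus ` B" "- i \<in> uminus ` B" "nest_less (- j) (- i)"
      using sym[OF B(1)] B by (simp_all add: nest_less_uminus)
    ultimately show ?thesis unfolding arcs_def by blast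
  qed
qed

text \<open>The existence of an arc ending in \<open>n\<close> encodes the condition that the zero block is not a single
  pair: the block of an arc \<open>(n, -n)\<close> is the zero block, and its further elements come in pairs
  \<open>x\<close>, \<open>- x\<close>, of which the positive one precedes \<open>n\<close>.\<close>

lemma nonnesting_arcs_if_nonnesting_D:
  assumes "nonnesting_D n P"
  shows "nonnesting_arcs n (arcs P)"
proof -
  have P: "partition_on (pm_interval n) P"
    and sym: "\<And>B. B \<in> P \<Longrightarrow> uminus ` B \<in> P"
    and D: "\<And>B i. B \<in> P \<Longrightarrow> B = uminus ` B \<Longrightarrow> B \<noteq> {i, - i}"
    and mid: "\<And>i. (i, - i) \<in> arcs P \<Longrightarrow> i = int n"
    and nest: "\<forall>p\<in>arcs P. \<forall>q\<in>arcs P. nests p q \<longrightarrow> exceptional n (arcs P) p q"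
    using assms
    unfolding nonnesting_D_def set_partition_D_def set_partition_C_def nesting_exception_arcs
    by metis+
  have "\<exists>k. (k, int n) \<in> arcs P" if arc: "(int n, - int n) \<in> arcs P"
  proof -
    obtain B where B: "B \<in> P" "int n \<in> B" "- int n \<in> B"
      using arc by (rule arcsE)
    have "- int n \<in> uminus ` B" using B by blast
    then have zero: "B = uminus ` B" using block_eq[OF P B(1) sym[OF B(1)] B(3)] by blast
    then obtain x where x: "x \<in> B" "x \<noteq> int n" "x \<noteq> - int n"
      using D[OF B(1), of "int n"] B by blast
    have "- x \<in> B" using x zero by blast
    then have "\<bar>x\<bar> \<in> B" using x by (simp add: abs_if)
    moreover have "x \<noteq> 0" "\<bar>x\<bar> \<le> int n"
      using x(1) block_subset[OF P B(1)] mem_pm_interval by blast+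
    then have "nest_less \<bar>x\<bar> (int n)"
      using x(2,3) by (auto simp: nest_less_def)
    ultimately have "(\<bar>x\<bar>, int n) \<in> (arcs P)\<^sup>+"
      using trancl_arcs_if_nest_less[OF P B(1)] B by blast
    then show ?thesis by (meson tranclD2)
  qed
  then show ?thesis
    unfolding nonnesting_arcs_def using symmetric_matching_arcs[OF P sym] mid nest by metis
qed

context
  fixes n A
  assumes A: "symmetric_matching n A"
begin

lemma rtrancl_matching_nest_less:
  assumes "(x, y) \<in> A\<^sup>*"
  shows "x = y \<or> nest_less x y"
  using assms
proof (induction rule: rtrancl_induct)
  case (step y z)
  then have "nest_less y z" using A unfolding symmetric_matching_def by blast
  then show ?case using step nest_less_trans by blast
qed simp

lemma rtrancl_matching_uminus: "(x, y) \<in> A\<^sup>* \<Longrightarrow> (- y, - x) \<in> A\<^sup>*"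
proof (induction rule: rtrancl_induct)
  case (step y z)
  then have "(- z, - y) \<in> A" using A unfolding symmetric_matching_def by blast
  then show ?case using step.IH by (rule converse_rtrancl_into_rtrancl)
qed simp

text \<open>Transitivity holds because two paths that start in the same vertex, or that end in the same
  vertex, are such that one of them extends the other.\<close>

lemma equiv_same_path: "equiv (pm_interval n) (same_path n A)"
proof (rule equivI)
  have sv: "single_valued A" "single_valued (A\<inverse>)"
    using A by (auto simp: symmetric_matching_def)
  show "refl_on (pm_interval n) (same_path n A)"
    by (auto simp: refl_on_def same_path_def)
  show "sym (same_path n A)" by (auto simp: sym_def same_path_def)
  have "(x, z) \<in> A\<^sup>* \<or> (z, x) \<in> A\<^sup>*"
    if "(x, y) \<in> A\<^sup>* \<or> (y, x) \<in> A\<^sup>*" "(y, z) \<in> A\<^sup>* \<or> (z, y) \<in> A\<^sup>*" for x y z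
    using that single_valued_confluent[OF sv(1), of y] 
      single_valued_confluent[OF sv(2), of y, unfolded rtrancl_converse]
    by (meson converse_iff rtrancl_trans)
  then show "trans (same_path n A)"
    unfolding trans_def same_path_def by blast
qed (auto simp: same_path_def)

lemma partition_on_path_blocks: "partition_on (pm_interval n) (path_blocks n A)"
  unfolding path_blocks_def using equiv_same_path by (rule partition_on_quotient)

lemma same_block_path_blocks:
  "(\<exists>B\<in>path_blocks n A. x \<in> B \<and> y \<in> B) \<longleftrightarrow> (x, y) \<in> same_path n A"
  using quotient_eq_iff[OF equiv_same_path] equiv_class_eq_iff[OF equiv_same_path]
  unfolding path_blocks_def
  by (metis equiv_class_self[OF equiv_same_path] quotientI in_quotient_imp_subset[OF equiv_same_path]
      subsetD Image_singleton_iff)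

text \<open>The first arc on the path from \<open>i\<close> to a later element \<open>k\<close> of its block is the unique arc starting in
  \<open>i\<close>. Its end is therefore the element of the block that immediately follows \<open>i\<close>.\<close>

lemma arcs_path_blocks: "arcs (path_blocks n A) = A"
proof (rule set_eqI, clarify)
  fix i j
  let ?P = "path_blocks n A"
  note P = partition_on_path_blocks
  have up: "\<And>i j. (i, j) \<in> A \<Longrightarrow> nest_less i j" and sv: "single_valued A"
    and sub: "A \<subseteq> pm_interval n \<times> pm_interval n"
    using A by (auto simp: symmetric_matching_def)
  show "(i, j) \<in> arcs ?P \<longleftrightarrow> (i, j) \<in> A"
  proof
    assume "(i, j) \<in> arcs ?P"
    then obtain B where B: "B \<in> ?P" "i \<in> B" "j \<in> B" "nest_less i j"
      and no: "\<not> (\<exists>k\<in>B. nest_less i k \<and> nest_less k j)"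
      unfolding arcs_def by blast
    have "(i, j) \<in> A\<^sup>* \<or> (j, i) \<in> A\<^sup>*"
      using same_block_path_blocks[of i j] B unfolding same_path_def by blast
    then have "(i, j) \<in> A\<^sup>*"
      using rtrancl_matching_nest_less B(4) nest_less_trans nest_less_irrefl by blast
    moreover have "i \<noteq> j" using B(4) nest_less_irrefl by blast
    ultimately obtain m where m: "(i, m) \<in> A" "(m, j) \<in> A\<^sup>*"
      by (meson converse_rtranclE)
    then have "(i, m) \<in> same_path n A"
      using sub unfolding same_path_def by blast
    then obtain B' where "B' \<in> ?P" "i \<in> B'" "m \<in> B'"
      using same_block_path_blocks[of i m] by blast
    then have "m \<in> B" using block_eq[OF P] B by blast
    then show "(i, j) \<in> A"
      using no up[OF m(1)] rtrancl_matching_nest_less[OF m(2)] m(1) by blast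
  next
    assume ij: "(i, j) \<in> A"
    then have "(i, j) \<in> same_path n A"
      using sub unfolding same_path_def by blast
    then obtain B where B: "B \<in> ?P" "i \<in> B" "j \<in> B"
      using same_block_path_blocks[of i j] by blast
    have "\<not> (nest_less i k \<and> nest_less k j)" if "k \<in> B" for k
    proof
      assume k: "nest_less i k \<and> nest_less k j"
      have "(i, k) \<in> A\<^sup>* \<or> (k, i) \<in> A\<^sup>*"
        using same_block_path_blocks[of i k] B that unfolding same_path_def by blast
      then have "(i, k) \<in> A\<^sup>*"
        using rtrancl_matching_nest_less k nest_less_trans nest_less_irrefl by blast
      then obtain m where "(i, m) \<in> A" "(m, k) \<in> A\<^sup>*"
        using k nest_less_irrefl by (metis converse_rtranclE)
      then have "(j, k) \<in> A\<^sup>*" using single_valuedD[OF sv ij] by blast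
      then show False
        using k rtrancl_matching_nest_less nest_less_trans nest_less_irrefl by blast
    qed
    then show "(i, j) \<in> arcs ?P"
      unfolding arcs_def using B up[OF ij] by blast
  qed
qed

lemma uminus_path_blocks:
  assumes "B \<in> path_blocks n A"
  shows "uminus ` B \<in> path_blocks n A"
proof -
  obtain x where x: "x \<in> pm_interval n" "B = same_path n A `` {x}"
    using assms unfolding path_blocks_def by (rule quotientE)
  have neg: "(- x, - y) \<in> same_path n A" if "(x, y) \<in> same_path n A" for x y
    using that rtrancl_matching_uminus unfolding same_path_def
    by (auto simp: mem_pm_interval)
  have "uminus ` B = same_path n A `` {- x}"
  proof (intro equalityI subsetI)
    fix y assume "y \<in> uminus ` B"
    then show "y \<in> same_path n A `` {- x}" using neg x by auto
  next
    fix y assume "y \<in> same_path n A `` {- x}"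
    then have "(x, - y) \<in> same_path n A" using neg[of "- x" y] by simp
    then show "y \<in> uminus ` B" using x by (metis ImageI imageI minus_minus singletonI)
  qed
  moreover have "- x \<in> pm_interval n" using x by (simp add: mem_pm_interval)
  ultimately show ?thesis unfolding path_blocks_def by (simp add: quotientI)
qed

text \<open>A block that equals its own negative has the same elements up to sign on both sides, so its
  largest positive element \<open>i\<close> is immediately followed by \<open>- i\<close>. Thus there are as many zero blocks
  as arcs of the form \<open>(i, - i)\<close>, and these are easy to control.\<close>

lemma zero_block_has_middle_arc:
  assumes B: "B \<in> path_blocks n A" and zero: "B = uminus ` B"
  shows "\<exists>i\<in>B. (i, - i) \<in> A"
proof -
  note P = partition_on_path_blocks
  define M where "M = Max {x \<in> B. 0 < x}"
  have "finite B"
    using block_subset[OF P B] finite_pm_interval finite_subset by blast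
  then have fin: "finite {x \<in> B. 0 < x}" by simp
  obtain x where "x \<in> B" using B P unfolding partition_on_def by fastforce
  moreover from this have "- x \<in> B" using zero by blast
  ultimately have "\<bar>x\<bar> \<in> {x \<in> B. 0 < x}"
    using block_nonzero[OF P B, of x] by (auto simp: abs_if)
  then have "{x \<in> B. 0 < x} \<noteq> {}" by blast
  then have M: "M \<in> B" "0 < M" using Max_in[OF fin] unfolding M_def by auto
  have le: "k \<le> M" if "k \<in> B" "0 < k" for k unfolding M_def using that fin by auto
  have "- k \<in> B" if "k \<in> B" for k using that zero by blast
  then have "\<not> (\<exists>k\<in>B. nest_less M k \<and> nest_less k (- M))"
    using le M(2) by (force simp: nest_less_def)
  moreover have "- M \<in> B" using M zero by blast
  ultimately have "(M, - M) \<in> arcs (path_blocks n A)"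
    unfolding arcs_def using B M by (auto simp: nest_less_def)
  then show ?thesis using arcs_path_blocks M by auto
qed

end

text \<open>The only possible arc of the form \<open>(i, - i)\<close> is \<open>(n, -n)\<close>, so that all zero blocks contain \<open>n\<close> and
  coincide.\<close>

lemma nonnesting_D_path_blocks:
  assumes "nonnesting_arcs n A"
  shows "nonnesting_D n (path_blocks n A)"
proof -
  have A: "symmetric_matching n A"
    and mid: "\<And>i. (i, - i) \<in> A \<Longrightarrow> i = int n \<and> (\<exists>k. (k, int n) \<in> A)"
    and nest: "\<forall>p\<in>A. \<forall>q\<in>A. nests p q \<longrightarrow> exceptional n A p q"
    using assms unfolding nonnesting_arcs_def by blast+
  let ?P = "path_blocks n A"
  note P = partition_on_path_blocks[OF A] and arcs = arcs_path_blocks[OF A]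
  have sym: "B \<in> ?P \<longleftrightarrow> uminus ` B \<in> ?P" for B
    using uminus_path_blocks[OF A, of B] uminus_path_blocks[OF A, of "uminus ` B"]
    by (auto simp: image_image)
  have n_mem: "int n \<in> B" if "B \<in> ?P" "B = uminus ` B" for B
    using zero_block_has_middle_arc[OF A that] mid by blast
  have "B \<noteq> {i, - i}" if B: "B \<in> ?P" "B = uminus ` B" for B i
  proof
    assume Bi: "B = {i, - i}"
    obtain k where k: "(k, int n) \<in> arcs ?P"
      using zero_block_has_middle_arc[OF A B] mid arcs by blast
    then obtain B' where "B' \<in> ?P" "k \<in> B'" "int n \<in> B'" unfolding arcs_def by blast
    then have "k \<in> B" using block_eq[OF P B(1)] n_mem[OF B] by blast
    moreover have "nest_less k (int n)" using arcs_nest_less[OF k] .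
    ultimately show False using n_mem[OF B] Bi by (auto simp: nest_less_def)
  qed
  moreover have "B = B'" if "B \<in> ?P" "B' \<in> ?P" "B = uminus ` B" "B' = uminus ` B'" for B B'
    using block_eq[OF P that(1,2)] n_mem that by blast
  ultimately show ?thesis
    unfolding nonnesting_D_def set_partition_D_def set_partition_C_def nesting_exception_arcs arcs
    using P sym mid nest by blast
qed

lemma bij_betw_arcs:
  "bij_betw arcs {P. nonnesting_D n P \<and> openers P = Op \<and> closers P = Cl}
     {A. nonnesting_arcs n A \<and> {i \<in> Domain A. 0 < i} = Op \<and> {i \<in> Range A. 0 < i} = Cl}"
proof (rule bij_betw_byWitness[where f' = "path_blocks n"])
  have part: "partition_on (pm_interval n) P" if "nonnesting_D n P" for P
    using that by (simp add: nonnesting_D_def set_partition_D_def set_partition_C_def)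
  have matching: "symmetric_matching n A" if "nonnesting_arcs n A" for A
    using that by (simp add: nonnesting_arcs_def)
  show "\<forall>P\<in>{P. nonnesting_D n P \<and> openers P = Op \<and> closers P = Cl}. path_blocks n (arcs P) = P"
    using path_blocks_arcs part by blast
  show "\<forall>A\<in>{A. nonnesting_arcs n A \<and> {i \<in> Domain A. 0 < i} = Op \<and> {i \<in> Range A. 0 < i} = Cl}.
      arcs (path_blocks n A) = A"
    using arcs_path_blocks matching by blast
  show "arcs ` {P. nonnesting_D n P \<and> openers P = Op \<and> closers P = Cl}
    \<subseteq> {A. nonnesting_arcs n A \<and> {i \<in> Domain A. 0 < i} = Op \<and> {i \<in> Range A. 0 < i} = Cl}"
  proof (rule image_subsetI, clarify)
    fix P assume P: "nonnesting_D n P"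
    show "nonnesting_arcs n (arcs P) \<and> {i \<in> Domain (arcs P). 0 < i} = openers P \<and>
        {i \<in> Range (arcs P). 0 < i} = closers P"
      using nonnesting_arcs_if_nonnesting_D[OF P] openers_eq_Domain_arcs[OF part[OF P]]
        closers_eq_Range_arcs[OF part[OF P]] by simp
  qed
  show "path_blocks n ` {A. nonnesting_arcs n A \<and> {i \<in> Domain A. 0 < i} = Op \<and> {i \<in> Range A. 0 < i} = Cl}
    \<subseteq> {P. nonnesting_D n P \<and> openers P = Op \<and> closers P = Cl}"
  proof (rule image_subsetI, clarify)
    fix A assume A: "nonnesting_arcs n A"
    show "nonnesting_D n (path_blocks n A) \<and> openers (path_blocks n A) = {i \<in> Domain A. 0 < i} \<and>
        closers (path_blocks n A) = {i \<in> Range A. 0 < i}"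
      using nonnesting_D_path_blocks[OF A] arcs_path_blocks[OF matching[OF A]]
        openers_eq_Domain_arcs[OF partition_on_path_blocks[OF matching[OF A]]]
        closers_eq_Range_arcs[OF partition_on_path_blocks[OF matching[OF A]]] by simp
  qed
qed

section \<open>Increasing bijections between finite sets\<close>

definition rank :: "int set \<Rightarrow> int \<Rightarrow> nat" where
  "rank S x = card {z \<in> S. z < x}"

text \<open>The increasing bijection between two finite sets of the same size, as a relation: it matches the
  elements that have the same number of predecessors.\<close>

definition order_match :: "int set \<Rightarrow> int set \<Rightarrow> (int \<times> int) set" where
  "order_match F D = {(x, y). x \<in> F \<and> y \<in> D \<and> rank F x = rank D y}"

lemma rank_less: "finite S \<Longrightarrow> x \<in> S \<Longrightarrow> x < y \<Longrightarrow> rank S x < rank S y"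
  unfolding rank_def by (rule psubset_card_mono) auto

lemma rank_less_card: "finite S \<Longrightarrow> x \<in> S \<Longrightarrow> rank S x < card S"
  unfolding rank_def by (rule psubset_card_mono) auto

lemma rank_less_iff:
  assumes "finite S" "x \<in> S" "y \<in> S"
  shows "rank S x < rank S y \<longleftrightarrow> x < y"
  using rank_less[OF assms(1,2), of y] rank_less[OF assms(1,3), of x]
  by (cases x y rule: linorder_cases) auto

lemma inj_on_rank: "finite S \<Longrightarrow> inj_on (rank S) S"
  by (rule inj_onI) (metis linorder_neqE rank_less less_irrefl)

lemma rank_image: "finite S \<Longrightarrow> rank S ` S = {..<card S}"
  by (rule card_subset_eq) (auto simp: rank_less_card card_image inj_on_rank)

lemma order_match_converse: "(order_match F D)\<inverse> = order_match D F"
  by (auto simp: order_match_def)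

lemma Domain_order_match:
  assumes "finite F" "finite D" "card F = card D"
  shows "Domain (order_match F D) = F"
proof -
  have "\<exists>y\<in>D. rank F x = rank D y" if "x \<in> F" for x
    using rank_less_card[OF assms(1) that] rank_image[OF assms(2)] assms(3) by (metis imageE lessThan_iff)
  then show ?thesis by (auto simp: order_match_def)
qed

lemma Range_order_match:
  assumes "finite F" "finite D" "card F = card D"
  shows "Range (order_match F D) = D"
  using Domain_order_match[OF assms(2,1)] assms(3)
  by (simp flip: order_match_converse[of F D])

lemma order_match_less_iff:
  assumes "finite F" "finite D" "(x, y) \<in> order_match F D" "(x', y') \<in> order_match F D"
  shows "x < x' \<longleftrightarrow> y < y'"
  using assms by (auto simp: order_match_def rank_less_iff[symmetric])

lemma single_valued_order_match: "finite D \<Longrightarrow> single_valued (order_match F D)"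
  by (rule single_valuedI) (auto simp: order_match_def dest: inj_onD[OF inj_on_rank])

text \<open>An increasing bijection restricts to a bijection between the elements below \<open>x\<close> and those below the
  partner of \<open>x\<close>, so it preserves ranks.\<close>

lemma order_match_unique:
  assumes fin: "finite F" "finite D" and sub: "M \<subseteq> F \<times> D"
    and dom: "F \<subseteq> Domain M" and ran: "D \<subseteq> Range M" and sv: "single_valued M"
    and mono: "\<And>x y x' y'. (x, y) \<in> M \<Longrightarrow> (x', y') \<in> M \<Longrightarrow> x < x' \<Longrightarrow> y < y'"
  shows "card F = card D \<and> M = order_match F D"
proof (rule conjI)
  have inj1: "inj_on fst M"
    using sv by (auto simp: inj_on_def single_valued_def)
  have inj2: "inj_on snd M"
  proof (rule inj_onI, clarify)
    fix x y x' y' assume *: "(x, y) \<in> M" "(x', y') \<in> M" and eq: "snd (x, y) = snd (x', y')"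
    have "x = x'" using mono[OF *] mono[OF *(2,1)] eq by (cases x x' rule: linorder_cases) auto
    then show "x = x' \<and> y = y'" using eq by simp
  qed
  have "fst ` M = F" "snd ` M = D"
    using sub dom ran by force+
  then show "card F = card D"
    using card_image[OF inj1] card_image[OF inj2] by simp
  have less_iff: "x < x' \<longleftrightarrow> y < y'" if "(x, y) \<in> M" "(x', y') \<in> M" for x y x' y'
    using mono[OF that] mono[OF that(2,1)] single_valuedD[OF sv, of x y y'] that
    by (cases x x' rule: linorder_cases) auto
  have sub_match: "M \<subseteq> order_match F D"
  proof clarify
    fix x y assume xy: "(x, y) \<in> M"
    define M' where "M' = {p \<in> M. fst p < x}"
    have "fst ` M' = {z \<in> F. z < x}"
      unfolding M'_def using sub dom by force
    moreover have "snd ` M' = {z \<in> D. z < y}"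
      unfolding M'_def using sub ran less_iff[OF _ xy] by force
    moreover have "card (fst ` M') = card M'" "card (snd ` M') = card M'"
      using inj1 inj2 unfolding M'_def by (auto intro!: card_image intro: inj_on_subset)
    ultimately show "(x, y) \<in> order_match F D"
      using xy sub unfolding order_match_def rank_def by auto
  qed
  moreover have "order_match F D \<subseteq> M"
  proof clarify
    fix x y assume xy: "(x, y) \<in> order_match F D"
    then obtain y' where "(x, y') \<in> M" using dom unfolding order_match_def by blast
    then show "(x, y) \<in> M"
      using sub_match xy single_valuedD[OF single_valued_order_match[OF fin(2)]] by blast
  qed
  ultimately show "M = order_match F D" by blast
qed

text \<open>As the partners are negated, this increasing bijection from \<open>T\<close> to \<open>- T\<close> is the order-reversing
  involution of \<open>T\<close>.\<close>

abbreviation reflected_match :: "int set \<Rightarrow> (int \<times> int) set" where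
  "reflected_match T \<equiv> order_match T (uminus ` T)"

lemma card_uminus_image: "card (uminus ` (T :: int set)) = card T"
  by (simp add: card_image)

text \<open>The set of the negated and flipped pairs is again an increasing bijection from \<open>T\<close> to \<open>- T\<close>, and
  there is only one.\<close>

lemma reflected_match_uminus:
  assumes "finite T" "(x, y) \<in> reflected_match T"
  shows "(- y, - x) \<in> reflected_match T"
proof -
  let ?M = "{(- y, - x) | x y. (x, y) \<in> reflected_match T}"
  have fin: "finite (uminus ` T)" using assms by simp
  note less_iff = order_match_less_iff[OF assms(1) fin]
  have dr: "Domain (reflected_match T) = T" "Range (reflected_match T) = uminus ` T"
    using Domain_order_match[OF assms(1) fin] Range_order_match[OF assms(1) fin]
    by (simp_all add: card_uminus_image)
  have "card T = card (uminus ` T) \<and> ?M = reflected_match T"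
  proof (rule order_match_unique)
    show "?M \<subseteq> T \<times> uminus ` T" by (auto simp: order_match_def)
    show "T \<subseteq> Domain ?M"
    proof
      fix t assume "t \<in> T"
      then have "- t \<in> Range (reflected_match T)" using dr by blast
      then show "t \<in> Domain ?M" by force
    qed
    show "uminus ` T \<subseteq> Range ?M"
    proof
      fix t assume "t \<in> uminus ` T"
      then have "- t \<in> Domain (reflected_match T)" using dr by auto
      then show "t \<in> Range ?M" by force
    qed
    show "single_valued ?M"
    proof (rule single_valuedI, clarify)
      fix x y x' y' :: int
      assume "(x, y) \<in> reflected_match T" "(x', y') \<in> reflected_match T" "- y = - y'"
      then show "- x = - x'"
        using less_iff[of x y x' y'] less_iff[of x' y' x y] by auto
    qed
    show "y < y'" if "(x, y) \<in> ?M" "(x', y') \<in> ?M" "x < x'" for x y x' y'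
      using that less_iff[of "- y'" "- x'" "- y" "- x"] by auto
  qed (use assms fin in auto)
  then show ?thesis using assms by blast
qed

lemma reflected_match_fixed_iff:
  assumes fin: "finite T" and x: "x \<in> T"
  shows "(x, - x) \<in> reflected_match T \<longleftrightarrow> card T = 2 * rank T x + 1"
proof -
  have "{z \<in> uminus ` T. z < - x} = uminus ` {z \<in> T. x < z}" by force
  then have "rank (uminus ` T) (- x) = card {z \<in> T. x < z}"
    unfolding rank_def by (simp add: card_uminus_image)
  moreover have "card T = rank T x + 1 + card {z \<in> T. x < z}"
  proof -
    have "T = insert x ({z \<in> T. z < x} \<union> {z \<in> T. x < z})" using x by auto
    then have "card T = card (insert x ({z \<in> T. z < x} \<union> {z \<in> T. x < z}))" by simp
    also have "\<dots> = Suc (card ({z \<in> T. z < x} \<union> {z \<in> T. x < z}))"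
      using fin by (subst card_insert_disjoint) auto
    also have "card ({z \<in> T. z < x} \<union> {z \<in> T. x < z}) = rank T x + card {z \<in> T. x < z}"
      unfolding rank_def using fin by (subst card_Un_disjoint) auto
    finally show ?thesis by simp
  qed
  ultimately show ?thesis using x by (auto simp: order_match_def)
qed

text \<open>The fixed point of the order-reversing involution is the middle element.\<close>

lemma reflected_match_has_fixed_iff:
  assumes fin: "finite T"
  shows "(\<exists>x. (x, - x) \<in> reflected_match T) \<longleftrightarrow> odd (card T)"
proof
  assume "\<exists>x. (x, - x) \<in> reflected_match T"
  then obtain x where x: "(x, - x) \<in> reflected_match T" by blast
  then have "x \<in> T" by (simp add: order_match_def)
  then show "odd (card T)" using reflected_match_fixed_iff[OF fin] x by simp
next
  assume "odd (card T)"
  then obtain m where m: "card T = 2 * m + 1" by (rule oddE)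
  then have "m \<in> rank T ` T" using rank_image[OF fin] by simp
  then obtain x where "x \<in> T" "rank T x = m" by blast
  then show "\<exists>x. (x, - x) \<in> reflected_match T"
    using reflected_match_fixed_iff[OF fin] m by blast
qed

section \<open>Arc sets determined by the openers with positive partners\<close>

text \<open>The four parts are the arcs between positive elements, their negatives, the arcs from positive to
  negative elements other than \<open>(n, -n)\<close>, and the arc \<open>(n, -n)\<close> if present. Here \<open>F\<close> is the set of
  openers whose partner is positive, and \<open>Z\<close> is meant to be empty or \<open>{n}\<close>.\<close>

definition arc_system :: "int set \<Rightarrow> int set \<Rightarrow> int set \<Rightarrow> int set \<Rightarrow> (int \<times> int) set" where
  "arc_system Op Cl F Z =
     order_match F Cl \<union> {(- j, - i) | i j. (i, j) \<in> order_match F Cl} \<union>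
     reflected_match (Op - F - Z) \<union> {(z, - z) | z. z \<in> Z}"

text \<open>The last condition describes a pair that is out of order: the arcs starting in \<open>s\<close> and \<open>x\<close> nest, and
  the only nesting of this kind that is allowed is that of \<open>(s, -n)\<close> and \<open>(x, n)\<close>. As \<open>-n\<close> is the first
  negative element and \<open>n\<close> the last positive one, monotonicity then forces \<open>s\<close> to be the first
  element outside \<open>F\<close> and \<open>x\<close> the last one of \<open>F\<close>.\<close>

definition admissible :: "nat \<Rightarrow> int set \<Rightarrow> int set \<Rightarrow> int set \<Rightarrow> int set \<Rightarrow> bool" where
  "admissible n Op Cl F Z \<longleftrightarrow>
     F \<subseteq> Op \<and> card F = card Cl \<and> even (card (Op - F - Z)) \<and>
     (Z = {} \<or> Z = {int n} \<and> int n \<in> Op - F \<and> int n \<in> Cl) \<and>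
     (\<forall>s\<in>Op - F. \<forall>x\<in>F. s < x \<longrightarrow>
        Z = {} \<and> int n \<in> Op - F \<and> int n \<in> Cl \<and> (\<forall>t\<in>Op - F. s \<le> t) \<and> (\<forall>t\<in>F. t \<le> x))"

text \<open>Exceptional nestings around \<open>(n, -n)\<close> disappear once this arc is split off, and all others involve
  two arcs of different kinds. So the arcs between positive elements and the remaining arcs from
  positive to negative elements each form an increasing bijection, which is unique.\<close>

lemma nonnesting_arcs_arc_system:
  assumes A: "nonnesting_arcs n A"
    and Op: "{i \<in> Domain A. 0 < i} = Op" and Cl: "{i \<in> Range A. 0 < i} = Cl"
  shows "\<exists>F Z. admissible n Op Cl F Z \<and> A = arc_system Op Cl F Z"
proof -
  have sub: "A \<subseteq> pm_interval n \<times> pm_interval n"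
    and up: "\<And>i j. (i, j) \<in> A \<Longrightarrow> nest_less i j"
    and sv: "\<And>x y z. (x, y) \<in> A \<Longrightarrow> (x, z) \<in> A \<Longrightarrow> y = z"
    and svc: "\<And>x y z. (y, x) \<in> A \<Longrightarrow> (z, x) \<in> A \<Longrightarrow> y = z"
    and sym: "\<And>i j. (i, j) \<in> A \<Longrightarrow> (- j, - i) \<in> A"
    and mid: "\<And>i. (i, - i) \<in> A \<Longrightarrow> i = int n \<and> (\<exists>k. (k, int n) \<in> A)"
    and nest: "\<And>p q. p \<in> A \<Longrightarrow> q \<in> A \<Longrightarrow> nests p q \<Longrightarrow> exceptional n A p q"
    using A unfolding nonnesting_arcs_def symmetric_matching_def single_valued_def converse_iff
    by blast+
  have bound: "x \<noteq> 0 \<and> \<bar>x\<bar> \<le> int n \<and> y \<noteq> 0 \<and> \<bar>y\<bar> \<le> int n" if "(x, y) \<in> A" for x y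
    using sub that by (auto simp: mem_pm_interval)
  have "Domain A \<subseteq> pm_interval n" "Range A \<subseteq> pm_interval n" using sub by auto
  then have finA: "finite (Domain A)" "finite (Range A)"
    using finite_pm_interval finite_subset by blast+
  define F where "F = {i. 0 < i \<and> (\<exists>j>0. (i, j) \<in> A)}"
  define Z where "Z = {i. (i, - i) \<in> A}"
  define T where "T = Op - F - Z"
  have FOp: "F \<subseteq> Op" unfolding F_def Op[symmetric] by auto
  have "finite Op" "finite Cl" using finA unfolding Op[symmetric] Cl[symmetric] by auto
  then have fin: "finite F" "finite Cl" "finite T" "finite (uminus ` T)"
    using FOp finite_subset unfolding T_def by auto
  define E where "E = {(i, j). (i, j) \<in> A \<and> 0 < i \<and> 0 < j}"
  have E: "card F = card Cl \<and> E = order_match F Cl"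
  proof (rule order_match_unique, goal_cases)
    case 4 then show ?case unfolding F_def E_def by auto
  next
    case 5
    show ?case
    proof
      fix y assume "y \<in> Cl"
      then obtain x where "(x, y) \<in> A" "0 < y" using Cl by blast
      then show "y \<in> Range E" using up[of x y] unfolding E_def nest_less_def by auto
    qed
  next
    case (7 x y x' y')
    then have xy: "(x, y) \<in> A" "0 < x" "0 < y" and xy': "(x', y') \<in> A" "0 < x'" "0 < y'"
      unfolding E_def by auto
    show ?case
    proof (rule ccontr)
      assume "\<not> y < y'"
      then have "y' < y" using svc[of x y x'] xy xy' 7(3) by (cases y y' rule: linorder_cases) auto
      then have "nests (x, y) (x', y')"
        using up[OF xy'(1)] xy xy' 7(3) by (auto simp: nests_def nest_less_def)
      then have "exceptional n A (x, y) (x', y')" using nest xy xy' by blast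
      then show False using xy xy' unfolding exceptional_def by auto
    qed
  qed (use fin in \<open>auto simp: E_def F_def Cl[symmetric] single_valued_def dest: sv\<close>)
  define M where "M = {(i, j). (i, j) \<in> A \<and> 0 < i \<and> j < 0 \<and> j \<noteq> - i}"
  have M_sym: "(- j, - i) \<in> M" if "(i, j) \<in> M" for i j
    using that sym[of i j] unfolding M_def by auto
  have M_fst: "i \<in> T" if "(i, j) \<in> M" for i j
  proof -
    have ij: "(i, j) \<in> A" "0 < i" "j < 0" "j \<noteq> - i" using that unfolding M_def by auto
    have "i \<in> Op" using ij unfolding Op[symmetric] by blast
    moreover have "i \<notin> F" using sv[OF ij(1)] ij(3) unfolding F_def by fastforce
    moreover have "i \<notin> Z" using sv[OF ij(1)] ij(4) unfolding Z_def by blast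
    ultimately show ?thesis unfolding T_def by blast
  qed
  have T_M: "\<exists>j. (i, j) \<in> M" if i: "i \<in> T" for i
  proof -
    obtain j where j: "(i, j) \<in> A" "0 < i" using i unfolding T_def Op[symmetric] by blast
    have "\<not> 0 < j" "j \<noteq> - i" using i j unfolding T_def F_def Z_def by auto
    then show ?thesis using j bound[OF j(1)] unfolding M_def by auto
  qed
  \<comment> \<open>only the third exception could spoil monotonicity, but its inner arc is not in \<open>M\<close>\<close>
  have M: "card T = card (uminus ` T) \<and> M = reflected_match T"
  proof (rule order_match_unique, goal_cases)
    case 3
    have "i \<in> T \<and> j \<in> uminus ` T" if "(i, j) \<in> M" for i j
      using M_fst[OF that] M_fst[OF M_sym[OF that]] by (metis image_eqI minus_minus)
    then show ?case by auto
  next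
    case 4 show ?case using T_M by blast
  next
    case 5
    show ?case
    proof
      fix y assume "y \<in> uminus ` T"
      then have "- y \<in> T" by auto
      then obtain j where "(- y, j) \<in> M" using T_M by blast
      from M_sym[OF this] show "y \<in> Range M" by auto
    qed
  next
    case (7 x y x' y')
    then have xy: "(x, y) \<in> A" "0 < x" "y < 0" and xy': "(x', y') \<in> A" "0 < x'" "y' < 0" "y' \<noteq> - x'"
      unfolding M_def by auto
    show ?case
    proof (rule ccontr)
      assume "\<not> y < y'"
      then have "y' < y" using svc[of x y x'] xy xy' 7(3) by (cases y y' rule: linorder_cases) auto
      then have "nests (x, y) (x', y')"
        using xy xy' 7(3) by (auto simp: nests_def nest_less_def)
      then have "exceptional n A (x, y) (x', y')" using nest xy xy' by blast
      then show False using xy xy' unfolding exceptional_def by auto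
    qed
  qed (use fin in \<open>auto simp: M_def single_valued_def dest: sv\<close>)
  have nZ: "z = int n \<and> int n \<in> Op - F \<and> int n \<in> Cl" if "z \<in> Z" for z
  proof -
    have z: "(z, - z) \<in> A" "z = int n" and "\<exists>k. (k, int n) \<in> A"
      using that mid[of z] unfolding Z_def by auto
    moreover have "0 < int n" using up[OF z(1)] z(2) by (auto simp: nest_less_def)
    moreover have "\<not> (\<exists>j>0. (int n, j) \<in> A)" using sv[of "int n" "- int n"] z by fastforce
    ultimately show ?thesis unfolding Op[symmetric] Cl[symmetric] F_def by blast
  qed
  have Z: "Z = {} \<or> Z = {int n} \<and> int n \<in> Op - F \<and> int n \<in> Cl" using nZ by blast
  have even: "even (card T)"
    using reflected_match_has_fixed_iff[OF fin(3)] M unfolding M_def by auto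
  \<comment> \<open>the arc starting in \<open>s\<close> ends in a negative element and nests the one starting in \<open>x\<close>\<close>
  have gap: "(s, - int n) \<in> A \<and> (x, int n) \<in> A \<and> x < int n"
    if s: "s \<in> Op - F" and x: "x \<in> F" and less: "s < x" for s x
  proof -
    obtain t where t: "(s, t) \<in> A" "0 < s" using s unfolding Op[symmetric] by blast
    then have "\<not> 0 < t" using s unfolding F_def by blast
    then have "t < 0" using bound[OF t(1)] by simp
    obtain y where y: "(x, y) \<in> A" "0 < x" "0 < y" using x unfolding F_def by blast
    have "nests (s, t) (x, y)"
      using up[OF y(1)] t y \<open>t < 0\<close> less by (auto simp: nests_def nest_less_def)
    then have "exceptional n A (s, t) (x, y)" using nest t y by blast
    then have "t = - int n \<and> y = int n \<and> x < int n"
      using t y \<open>t < 0\<close> unfolding exceptional_def by auto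
    then show ?thesis using t y by simp
  qed
  have "Z = {} \<and> int n \<in> Op - F \<and> int n \<in> Cl \<and> (\<forall>t\<in>Op - F. s \<le> t) \<and> (\<forall>t\<in>F. t \<le> x)"
    if s: "s \<in> Op - F" and x: "x \<in> F" and less: "s < x" for s x
  proof (intro conjI ballI)
    note g = gap[OF s x less]
    have pos: "0 < s" "0 < int n" using s x g unfolding Op[symmetric] F_def by auto
    show "Z = {}"
    proof (rule ccontr)
      assume "Z \<noteq> {}"
      then have "(int n, - int n) \<in> A" using nZ unfolding Z_def by blast
      then show False using svc[of s "- int n" "int n"] g less by auto
    qed
    show "int n \<in> Cl" using g pos unfolding Cl[symmetric] by blast
    have "(int n, - s) \<in> A" using sym[of s "- int n"] g by simp
    moreover from this have "\<not> (\<exists>j>0. (int n, j) \<in> A)"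
      using sv[of "int n" "- s"] pos by fastforce
    ultimately show "int n \<in> Op - F" using pos unfolding Op[symmetric] F_def by blast
    show "s \<le> t" if t: "t \<in> Op - F" for t
      using gap[OF t x] svc[of s "- int n" t] g less by fastforce
    show "t \<le> x" if t: "t \<in> F" for t
      using gap[OF s t] svc[of x "int n" t] g less by fastforce
  qed
  then have "admissible n Op Cl F Z"
    unfolding admissible_def using FOp E even Z unfolding T_def by blast
  moreover have "A = arc_system Op Cl F Z"
  proof -
    have "A = E \<union> {(- j, - i) | i j. (i, j) \<in> E} \<union> M \<union> {(z, - z) | z. z \<in> Z}" (is "A = ?U")
    proof (rule equalityI; rule subrelI)
      fix i j assume ij: "(i, j) \<in> A"
      consider "0 < i" "0 < j" | "0 < i" "j < 0" | "i < 0" "j < 0"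
        using up[OF ij] by (auto simp: nest_less_def)
      then show "(i, j) \<in> ?U"
      proof cases
        case 3
        then have "(- j, - i) \<in> E" using sym[OF ij] unfolding E_def by auto
        then show ?thesis by force
      qed (use ij in \<open>auto simp: E_def M_def Z_def\<close>)
    next
      fix i j assume "(i, j) \<in> ?U"
      moreover have "(i, j) \<in> A" if "(- j, - i) \<in> A" using sym[OF that] by simp
      ultimately show "(i, j) \<in> A" by (auto simp: E_def M_def Z_def)
    qed
    then show ?thesis unfolding arc_system_def using E M unfolding T_def by simp
  qed
  ultimately show ?thesis by blast
qed

text \<open>Negating a pair of arcs interchanges the first two exceptions and preserves the third one.\<close>

lemma exceptional_uminus:
  assumes "exceptional n A (- b, - a) (- d, - c)"
  shows "exceptional n A (a, b) (c, d)"
  using assms unfolding exceptional_def[of n A "(- b, - a)"]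
proof (elim disjE exE conjE)
  fix i j
  assume "0 < i" "i < j" "j < int n" "(- b, - a) = (i, - int n)" "(- d, - c) = (j, int n)"
  then have "0 < i \<and> i < j \<and> j < int n \<and> (a, b) = (int n, - i) \<and> (c, d) = (- int n, - j)"
    by auto
  then show "?thesis" unfolding exceptional_def by blast
next
  fix i j
  assume "0 < i" "i < j" "j < int n" "(- b, - a) = (int n, - i)" "(- d, - c) = (- int n, - j)"
  then have "0 < i \<and> i < j \<and> j < int n \<and> (a, b) = (i, - int n) \<and> (c, d) = (j, int n)"
    by auto
  then show "?thesis" unfolding exceptional_def by blast
next
  fix i j k
  assume "0 < k" "(k, int n) \<in> A" "k < i" "i < int n" "k < j" "j < int n"
    "(- b, - a) = (i, - j)" "(- d, - c) = (int n, - int n)"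
  then have "0 < k \<and> (k, int n) \<in> A \<and> k < j \<and> j < int n \<and> k < i \<and> i < int n \<and>
      (a, b) = (j, - i) \<and> (c, d) = (int n, - int n)" by auto
  then show "?thesis" unfolding exceptional_def by blast
qed

text \<open>This is where the opener-closer configuration is used: it ensures that an opener in \<open>F\<close> is smaller
  than the closer of the same rank. By symmetry under negation, the only nestings to be considered are
  those where the inner arc joins two positive elements or a positive and a negative one.\<close>

lemma arc_system_nonnesting_arcs:
  assumes occ: "opener_closer_config n Op Cl" and adm: "admissible n Op Cl F Z"
  shows "nonnesting_arcs n (arc_system Op Cl F Z)" (is "nonnesting_arcs n ?A")
    and "{i \<in> Domain (arc_system Op Cl F Z). 0 < i} = Op"
    and "{i \<in> Range (arc_system Op Cl F Z). 0 < i} = Cl"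
proof -
  have Op: "Op \<subseteq> {1..int n}" and Cl: "Cl \<subseteq> {1..int n}"
    and config: "\<And>k. k < n \<Longrightarrow> card (Cl \<inter> {1..int (k + 1)}) \<le> card (Op \<inter> {1..int k})"
    using occ unfolding opener_closer_config_def by auto
  define T where "T = Op - F - Z"
  define E where "E = order_match F Cl"
  define M where "M = reflected_match T"
  have FOp: "F \<subseteq> Op" and cardF: "card F = card Cl" and even: "even (card T)"
    and Z: "Z = {} \<or> Z = {int n} \<and> int n \<in> Op - F \<and> int n \<in> Cl"
    and gap: "\<And>s x. s \<in> Op - F \<Longrightarrow> x \<in> F \<Longrightarrow> s < x \<Longrightarrow>
        Z = {} \<and> int n \<in> Op - F \<and> int n \<in> Cl \<and> (\<forall>t\<in>Op - F. s \<le> t) \<and> (\<forall>t\<in>F. t \<le> x)"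
    using adm unfolding admissible_def T_def by blast+
  have finOC: "finite Op" "finite Cl"
    using Op Cl finite_subset[OF _ finite_atLeastAtMost_int] by auto
  then have fin: "finite Op" "finite Cl" "finite F" "finite T" "finite (uminus ` T)"
    using finite_subset[OF FOp] unfolding T_def by auto
  have F_bound: "1 \<le> x \<and> x \<le> int n" if "x \<in> F" for x using that FOp Op by auto
  have Cl_bound: "1 \<le> x \<and> x \<le> int n" if "x \<in> Cl" for x using that Cl by auto
  have T_bound: "1 \<le> x \<and> x \<le> int n" if "x \<in> T" for x using that Op unfolding T_def by auto
  have E_dom: "Domain E = F" and E_ran: "Range E = Cl"
    unfolding E_def
    using Domain_order_match[OF fin(3,2) cardF] Range_order_match[OF fin(3,2) cardF] by auto
  have M_dom: "Domain M = T" and M_ran: "Range M = uminus ` T"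
    unfolding M_def
    using Domain_order_match[OF fin(4,5)] Range_order_match[OF fin(4,5)]
    by (simp_all add: card_uminus_image)
  have E_mem: "x \<in> F \<and> y \<in> Cl" if "(x, y) \<in> E" for x y using that E_dom E_ran by blast
  have M_mem: "x \<in> T \<and> - y \<in> T" if "(x, y) \<in> M" for x y
    using that unfolding M_def order_match_def by auto
  have M_sym: "(- y, - x) \<in> M" if "(x, y) \<in> M" for x y
    using that reflected_match_uminus fin unfolding M_def by blast
  have E_sv: "y = z" if "(x, y) \<in> E" "(x, z) \<in> E" for x y z
    using that single_valued_order_match[OF fin(2)] unfolding E_def single_valued_def by blast
  have M_sv: "y = z" if "(x, y) \<in> M" "(x, z) \<in> M" for x y z
    using that single_valued_order_match[OF fin(5)] unfolding M_def single_valued_def by blast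
  have E_mono: "x < x' \<longleftrightarrow> y < y'" if "(x, y) \<in> E" "(x', y') \<in> E" for x y x' y'
    using that order_match_less_iff[OF fin(3,2)] unfolding E_def by blast
  have M_mono: "x < x' \<longleftrightarrow> y < y'" if "(x, y) \<in> M" "(x', y') \<in> M" for x y x' y'
    using that order_match_less_iff[OF fin(4,5)] unfolding M_def by blast
  \<comment> \<open>increasing bijections map the last element to the last element\<close>
  have E_last: "y = int n" if xy: "(x, y) \<in> E" and max: "\<forall>t\<in>F. t \<le> x" and n: "int n \<in> Cl" for x y
  proof -
    obtain x' where x': "(x', int n) \<in> E" using E_ran n by blast
    have "\<not> int n < y" using E_mem[OF xy] Cl_bound[of y] by auto
    then have "\<not> x' < x" using E_mono[OF x' xy] by simp
    then have "x' = x" using max E_mem[OF x'] by fastforce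
    then show ?thesis using E_sv x' xy by blast
  qed
  have E_less: "x < y" if xy: "(x, y) \<in> E" for x y
  proof (cases "\<exists>s\<in>Op - F. s < x")
    case True
    then obtain s where "s \<in> Op - F" "s < x" by blast
    note g = gap[OF this(1) _ this(2)]
    have x: "x \<in> F" using E_mem[OF xy] by blast
    have "y = int n" using E_last[OF xy] g[OF x] by blast
    moreover have "x \<noteq> int n" using g[OF x] x by blast
    ultimately show ?thesis using F_bound[OF x] by simp
  next
    case False
    show ?thesis
    proof (rule ccontr)
      assume "\<not> x < y"
      then have "y \<le> x" by simp
      have x: "x \<in> F" and y: "y \<in> Cl" using E_mem[OF xy] by auto
      have y1: "1 \<le> y" "y \<le> int n" using Cl_bound[OF y] by auto
      \<comment> \<open>if \<open>y \<le> x\<close>, too few openers precede \<open>y\<close> to be matched with the closers up to \<open>y\<close>\<close>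
      define k where "k = nat (y - 1)"
      have k: "k < n" "int k = y - 1" "int (k + 1) = y" using y1 unfolding k_def by auto
      have "Cl \<inter> {1..y} = insert y {z \<in> Cl. z < y}" using y Cl_bound y1 by fastforce
      then have "card (Cl \<inter> {1..y}) = rank Cl y + 1"
        unfolding rank_def using fin(2) by simp
      moreover have "Op \<inter> {1..y - 1} \<subseteq> {z \<in> F. z < x}"
        using False \<open>y \<le> x\<close> by force
      then have "card (Op \<inter> {1..y - 1}) \<le> rank F x"
        unfolding rank_def using fin(3) by (intro card_mono) auto
      moreover have "rank F x = rank Cl y" using xy unfolding E_def order_match_def by simp
      ultimately show False using config[OF k(1)] k by simp
    qed
  qed
  have A_iff: "(i, j) \<in> ?A \<longleftrightarrow>
      (i, j) \<in> E \<or> (- j, - i) \<in> E \<or> (i, j) \<in> M \<or> (i \<in> Z \<and> j = - i)" for i j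
  proof -
    have "(i, j) \<in> {(- y, - x) | x y. (x, y) \<in> E} \<longleftrightarrow> (- j, - i) \<in> E"
    proof
      assume "(- j, - i) \<in> E"
      then show "(i, j) \<in> {(- y, - x) | x y. (x, y) \<in> E}"
        by (intro CollectI exI[of _ "- j"] exI[of _ "- i"]) simp
    qed auto
    then show ?thesis
      unfolding arc_system_def E_def[symmetric] T_def[symmetric] M_def[symmetric] by auto
  qed
  have A_cases: thesis
    if ij: "(i, j) \<in> ?A"
      and r1: "(i, j) \<in> E \<Longrightarrow> i \<in> F \<Longrightarrow> j \<in> Cl \<Longrightarrow> 0 < i \<Longrightarrow> i < j \<Longrightarrow> j \<le> int n \<Longrightarrow> thesis"
      and r2: "(- j, - i) \<in> E \<Longrightarrow> - i \<in> Cl \<Longrightarrow> j < 0 \<Longrightarrow> i < j \<Longrightarrow> - int n \<le> i \<Longrightarrow> thesis"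
      and r3: "(i, j) \<in> M \<Longrightarrow> i \<in> T \<Longrightarrow> - j \<in> T \<Longrightarrow> 0 < i \<Longrightarrow> i \<le> int n \<Longrightarrow> j < 0 \<Longrightarrow> - int n \<le> j \<Longrightarrow> thesis"
      and r4: "i = int n \<Longrightarrow> j = - int n \<Longrightarrow> 0 < n \<Longrightarrow> Z = {int n} \<Longrightarrow> int n \<in> Op - F \<Longrightarrow> int n \<in> Cl \<Longrightarrow> thesis"
    for i j thesis
  proof -
    consider "(i, j) \<in> E" | "(- j, - i) \<in> E" | "(i, j) \<in> M" | "i \<in> Z" "j = - i"
      using ij A_iff by blast
    then show thesis
    proof cases
      case 1 then show ?thesis
        using r1 E_mem[OF 1] E_less[OF 1] F_bound[of i] Cl_bound[of j] by auto
    next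
      case 2 then show ?thesis
        using r2 E_mem[OF 2] E_less[OF 2] F_bound[of "- j"] Cl_bound[of "- i"] by auto
    next
      case 3 then show ?thesis
        using r3 M_mem[OF 3] T_bound[of i] T_bound[of "- j"] by auto
    next
      case 4 then show ?thesis using r4 Z Cl_bound[of "int n"] by auto
    qed
  qed
  have A_sym: "(- j, - i) \<in> ?A" if "(i, j) \<in> ?A" for i j
    using that M_sym[of i j] unfolding A_iff by auto
  have A_sv: "y = z" if xy: "(x, y) \<in> ?A" and xz: "(x, z) \<in> ?A" for x y z
  proof -
    have not_T: "x \<notin> T" if "x \<in> F \<or> x \<in> Z" for x using that unfolding T_def by blast
    have neg: "- y = - z" if "(- y, - x) \<in> E" "(- z, - x) \<in> E"
      using E_mono[OF that] E_mono[OF that(2,1)] by simp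
    show ?thesis using xy
    proof (rule A_cases)
      assume "(x, y) \<in> E" "x \<in> F" "0 < x"
      with xz not_T[of x] show ?thesis by - (erule A_cases; use E_sv in auto)
    next
      assume "(- y, - x) \<in> E" "y < 0" "x < y"
      with xz neg show ?thesis by - (erule A_cases; simp)
    next
      assume "(x, y) \<in> M" "x \<in> T" "0 < x"
      with xz not_T[of x] show ?thesis by - (erule A_cases; use M_sv in auto)
    next
      assume "x = int n" "y = - int n" "0 < n" "Z = {int n}" "int n \<in> Op - F"
      with xz not_T[of x] show ?thesis by - (erule A_cases; auto)
    qed
  qed
  have A_up: "nest_less i j" if "(i, j) \<in> ?A" for i j
    using that by (rule A_cases) (auto simp: nest_less_def)
  have matching: "symmetric_matching n ?A"
    unfolding symmetric_matching_def
  proof (intro conjI allI impI)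
    show "?A \<subseteq> pm_interval n \<times> pm_interval n"
    proof (rule subrelI)
      fix i j assume "(i, j) \<in> ?A"
      then show "(i, j) \<in> pm_interval n \<times> pm_interval n"
        by (rule A_cases) (auto simp: mem_pm_interval)
    qed
    show "single_valued ?A" using A_sv unfolding single_valued_def by blast
    have "y = z" if "(y, x) \<in> ?A" "(z, x) \<in> ?A" for x y z
      using A_sv[OF A_sym[OF that(1)] A_sym[OF that(2)]] by simp
    then show "single_valued (?A\<inverse>)" unfolding single_valued_def by blast
    show "nest_less i j" if "(i, j) \<in> ?A" for i j using A_up[OF that] .
    show "(- j, - i) \<in> ?A" if "(i, j) \<in> ?A" for i j using A_sym[OF that] .
  qed
  have mid: "i = int n \<and> (\<exists>k. (k, int n) \<in> ?A)" if "(i, - i) \<in> ?A" for i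
    using that
  proof (rule A_cases)
    assume "(i, - i) \<in> M"
    then have False using reflected_match_has_fixed_iff[OF fin(4)] even unfolding M_def by blast
    then show ?thesis ..
  next
    assume "i = int n" "int n \<in> Cl"
    then show ?thesis using E_ran A_iff by blast
  qed auto
  have nest_E: "exceptional n ?A (a, b) (c, d)"
    if p: "(a, b) \<in> ?A" and q: "(c, d) \<in> E" and nests: "nests (a, b) (c, d)" for a b c d
  proof -
    have cd: "c \<in> F" "0 < c" "c < d" "d \<le> int n"
      using E_mem[OF q] E_less[OF q] F_bound Cl_bound by force+
    have ac: "0 < a" "a < c" "nest_less d b"
      using nests cd unfolding nests_def nest_less_def by auto
    show ?thesis using p
    proof (rule A_cases)
      assume ab: "(a, b) \<in> E" "0 < a" "a < b"
      then have "d < b" using ac cd by (auto simp: nest_less_def)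
      then show ?thesis using E_mono[OF ab(1) q] ac by simp
    next
      assume ab: "(a, b) \<in> M" "a \<in> T" "- int n \<le> b"
      then have a: "a \<in> Op - F" unfolding T_def by blast
      note g = gap[OF a cd(1) ac(2)]
      have "d = int n" using E_last[OF q] g by blast
      \<comment> \<open>\<open>a\<close> is the first element of \<open>T\<close>, so its partner is the first element of \<open>- T\<close>, which is \<open>- n\<close>\<close>
      have "int n \<in> T" using g unfolding T_def by blast
      then obtain a' where a': "(a', - int n) \<in> M" using M_ran by blast
      have "a \<le> a'" using g M_mem[OF a'] unfolding T_def by blast
      moreover have "\<not> a < a'" using M_mono[OF ab(1) a'] ab by simp
      ultimately have "b = - int n" using M_sv a' ab by force
      then show ?thesis
        unfolding exceptional_def using \<open>d = int n\<close> ac cd by blast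
    qed (use ac cd in auto)
  qed
  have "exceptional n ?A (a, b) (c, d)"
    if p: "(a, b) \<in> ?A" and q: "(c, d) \<in> ?A" and nests: "nests (a, b) (c, d)" for a b c d
    using q
  proof (rule A_cases)
    assume "(c, d) \<in> E"
    then show ?thesis using nest_E p nests by blast
  next
    assume dc: "(- d, - c) \<in> E"
    have "nests (- b, - a) (- d, - c)"
      using nests unfolding nests_def by (simp add: nest_less_uminus)
    then show ?thesis using nest_E[OF A_sym[OF p] dc] exceptional_uminus by blast
  next
    assume cd: "(c, d) \<in> M" "0 < c" "d < 0" "c \<le> int n"
    then have "0 < a" "a < c" "b < 0" "d < b"
      using nests unfolding nests_def nest_less_def by auto
    with p cd show ?thesis by - (erule A_cases; use M_mono[OF _ cd(1)] in auto)
  next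
    assume cd: "c = int n" "d = - int n" "0 < n" "Z = {int n}" "int n \<in> Cl"
    then have ab: "0 < a" "a < int n" "b < 0" "- int n < b"
      using nests unfolding nests_def nest_less_def by auto
    obtain k where k: "(k, int n) \<in> E" using E_ran cd by blast
    \<comment> \<open>as \<open>Z\<close> is nonempty no pair is out of order, which is the proviso of the third exception\<close>
    have k_less: "k < s" if "s \<in> T" for s
    proof -
      have ks: "k \<in> F" "s \<in> Op - F" using E_mem[OF k] that unfolding T_def by auto
      then have "\<not> s < k" using gap[of s k] cd(4) by blast
      moreover have "s \<noteq> k" using ks by blast
      ultimately show ?thesis by simp
    qed
    show ?thesis using p
    proof (rule A_cases)
      assume "a \<in> T" "- b \<in> T"
      then have "k < a" "k < - b" using k_less by auto
      moreover have "0 < k" using F_bound E_mem[OF k] by force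
      moreover have "(k, int n) \<in> ?A" using k A_iff by blast
      ultimately show ?thesis
        unfolding exceptional_def using ab cd by (intro disjI2 exI[of _ a] exI[of _ "- b"] exI[of _ k]) auto
    qed (use ab in auto)
  qed
  then have "\<forall>p\<in>?A. \<forall>q\<in>?A. nests p q \<longrightarrow> exceptional n ?A p q" by auto
  then show "nonnesting_arcs n ?A"
    unfolding nonnesting_arcs_def using matching mid by blast
  have Op_split: "Op = F \<union> T \<union> Z" using FOp Z unfolding T_def by blast
  show "{i \<in> Domain ?A. 0 < i} = Op"
  proof (intro equalityI subsetI)
    fix i assume "i \<in> {i \<in> Domain ?A. 0 < i}"
    then obtain j where "(i, j) \<in> ?A" "0 < i" by blast
    then show "i \<in> Op" by - (erule A_cases; use Op_split in auto)
  next
    fix i assume i: "i \<in> Op"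
    then have "i \<in> Domain E \<or> i \<in> Domain M \<or> i \<in> Z" using Op_split E_dom M_dom by blast
    then have "i \<in> Domain ?A" using A_iff by blast
    then show "i \<in> {i \<in> Domain ?A. 0 < i}" using i Op by auto
  qed
  show "{i \<in> Range ?A. 0 < i} = Cl"
  proof (intro equalityI subsetI)
    fix j assume "j \<in> {j \<in> Range ?A. 0 < j}"
    then obtain i where "(i, j) \<in> ?A" "0 < j" by blast
    then show "j \<in> Cl" by - (erule A_cases; simp)
  next
    fix j assume j: "j \<in> Cl"
    then have "j \<in> Range ?A" using E_ran A_iff by blast
    then show "j \<in> {j \<in> Range ?A. 0 < j}" using j Cl by auto
  qed
qed

text \<open>The set \<open>F\<close> can be read off as the set of starting points of the arcs between positive elements.\<close>

lemma arc_system_inject: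
  assumes Op: "Op \<subseteq> {1..int n}" and Cl: "Cl \<subseteq> {1..int n}"
    and "admissible n Op Cl F Z" "admissible n Op Cl F' Z'"
    and eq: "arc_system Op Cl F Z = arc_system Op Cl F' Z'"
  shows "F = F'"
proof -
  have fin: "finite Op" "finite Cl"
    using Op Cl finite_subset[OF _ finite_atLeastAtMost_int] by auto
  have starts: "{i. 0 < i \<and> (\<exists>j>0. (i, j) \<in> arc_system Op Cl F Z)} = F"
    if adm: "admissible n Op Cl F Z" for F Z
  proof -
    have F: "F \<subseteq> Op" "card F = card Cl" and Z: "Z \<subseteq> {int n}"
      using adm unfolding admissible_def by auto
    have dom: "Domain (order_match F Cl) = F"
      using Domain_order_match[OF _ fin(2) F(2)] finite_subset[OF F(1) fin(1)] by blast
    have pos: "1 \<le> i \<and> 1 \<le> j" if "(i, j) \<in> order_match F Cl" for i j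
      using that F(1) Op Cl unfolding order_match_def by auto
    have neg: "j \<le> - 1" if "(i, j) \<in> reflected_match (Op - F - Z)" for i j
      using that Op unfolding order_match_def by auto
    have "(i, j) \<in> order_match F Cl"
      if "(i, j) \<in> arc_system Op Cl F Z" "0 < i" "0 < j" for i j
      using that pos[of "- j" "- i"] neg[of i j] Z unfolding arc_system_def by auto
    moreover have "0 < i \<and> 0 < j \<and> (i, j) \<in> arc_system Op Cl F Z"
      if "(i, j) \<in> order_match F Cl" for i j
      using that pos[OF that] unfolding arc_system_def by simp
    ultimately show ?thesis using dom by blast
  qed
  show ?thesis using starts[OF assms(3)] starts[OF assms(4)] unfolding eq by (rule trans[OF sym])
qed

section \<open>The admissible choices\<close>

definition initial :: "int set \<Rightarrow> nat \<Rightarrow> int set" where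
  "initial S q = {x \<in> S. rank S x < q}"

definition swapped :: "int set \<Rightarrow> nat \<Rightarrow> int set" where
  "swapped S q = insert (Min (S - initial S q)) (initial S q - {Max (initial S q)})"

lemma card_initial:
  assumes "finite S" "q \<le> card S"
  shows "card (initial S q) = q"
proof -
  have "rank S ` initial S q = {..<q}"
  proof (intro equalityI subsetI)
    fix r assume "r \<in> {..<q}"
    then have "r \<in> rank S ` S" using assms rank_image by auto
    then show "r \<in> rank S ` initial S q"
      using \<open>r \<in> {..<q}\<close> unfolding initial_def by auto
  qed (auto simp: initial_def)
  moreover have "inj_on (rank S) (initial S q)"
    using inj_on_rank[OF assms(1)] by (rule inj_on_subset) (auto simp: initial_def)
  ultimately show ?thesis using card_image by fastforce
qed

lemma initial_less:
  assumes "finite S" "x \<in> initial S q" "s \<in> S - initial S q"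
  shows "x < s"
proof -
  have "rank S x < rank S s" using assms(2,3) by (auto simp: initial_def)
  then show ?thesis using rank_less_iff[OF assms(1)] assms(2,3) by (auto simp: initial_def)
qed

lemma eq_initial:
  assumes fin: "finite S" and F: "F \<subseteq> S" "\<And>s x. s \<in> S - F \<Longrightarrow> x \<in> F \<Longrightarrow> x < s"
  shows "F = initial S (card F)"
proof (intro equalityI subsetI)
  have finF: "finite F" using fin F finite_subset by blast
  fix x assume x: "x \<in> F"
  then have "{z \<in> S. z < x} \<subset> F" using F by fastforce
  then show "x \<in> initial S (card F)"
    unfolding initial_def rank_def using x F psubset_card_mono[OF finF] by auto
next
  fix x assume x: "x \<in> initial S (card F)"
  show "x \<in> F"
  proof (rule ccontr)
    assume "x \<notin> F"
    then have "F \<subseteq> {z \<in> S. z < x}" using x F unfolding initial_def by blast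
    then have "card F \<le> rank S x" unfolding rank_def using fin by (intro card_mono) auto
    then show False using x unfolding initial_def by simp
  qed
qed

context
  fixes n :: nat and Op Cl :: "int set"
  assumes Op: "Op \<subseteq> {1..int n}" and card_Cl: "card Cl \<le> card (Op - {int n})"
    and fin_Cl: "finite Cl"
begin

private lemma fin_Op: "finite Op"
  using finite_subset[OF Op] by simp

private lemma card_le: "card Cl \<le> card Op"
  using card_Cl card_Diff1_le by (rule le_trans)

text \<open>The configuration inequality for \<open>k = n - 1\<close> leaves room for all partners of the closers among the openers
  different from \<open>n\<close>.\<close>

lemma last_not_initial: "int n \<notin> initial Op (card Cl)"
proof
  assume "int n \<in> initial Op (card Cl)"
  then have n: "int n \<in> Op" "rank Op (int n) < card Cl" unfolding initial_def by auto
  have "{z \<in> Op. z < int n} = Op - {int n}" using Op by fastforce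
  then show False using n card_Cl unfolding rank_def by simp
qed

lemma even_card_rest_iff:
  assumes "F \<subseteq> Op" "card F = card Cl"
  shows "even (card (Op - F)) \<longleftrightarrow> even (int (card Op) - int (card Cl))"
    and "int n \<in> Op - F \<Longrightarrow>
      even (card (Op - F - {int n})) \<longleftrightarrow> odd (int (card Op) - int (card Cl))"
proof -
  have fin: "finite F" using assms fin_Op finite_subset by blast
  have card: "int (card (Op - F)) = int (card Op) - int (card Cl)"
    using card_Diff_subset[OF fin assms(1)] assms(2) card_le by simp
  then show 1: "even (card (Op - F)) \<longleftrightarrow> even (int (card Op) - int (card Cl))"
    by (metis even_of_nat)
  assume n: "int n \<in> Op - F"
  have "Suc (card (Op - F - {int n})) = card (Op - F)"
    using card_Suc_Diff1[OF _ n] fin_Op by blast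
  then show "even (card (Op - F - {int n})) \<longleftrightarrow> odd (int (card Op) - int (card Cl))"
    using 1 by (metis even_Suc)
qed

text \<open>Only one pair is out of order. Exchanging its elements yields an initial segment with last element
  \<open>s\<close> and next opener \<open>x\<close>, so \<open>F\<close> arises from that segment by exchanging them back.\<close>

lemma admissible_gap_imp_swapped:
  assumes adm: "admissible n Op Cl F Z" and s: "s \<in> Op - F" and x: "x \<in> F" and "s < x"
  shows "F = swapped Op (card Cl)"
proof -
  have F: "F \<subseteq> Op" "card F = card Cl"
    and gap: "\<And>s x. s \<in> Op - F \<Longrightarrow> x \<in> F \<Longrightarrow> s < x \<Longrightarrow>
        (\<forall>t\<in>Op - F. s \<le> t) \<and> (\<forall>t\<in>F. t \<le> x)"
    using adm unfolding admissible_def by blast+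
  have fin: "finite F" using F fin_Op finite_subset by blast
  \<comment> \<open>two pairs out of order have the same first and the same last element\<close>
  have only: "u = s \<and> v = x" if "u \<in> Op - F" "v \<in> F" "u < v" for u v
    using gap[OF that] gap[OF s x \<open>s < x\<close>] that s x by (meson order_antisym)
  define F' where "F' = insert s (F - {x})"
  have rest: "Op - F' = insert x (Op - F - {s})"
    unfolding F'_def using F s x \<open>s < x\<close> by blast
  have "card F' = card F"
    unfolding F'_def using s card_Suc_Diff1[OF fin x] fin by simp
  moreover have "F' = initial Op (card F')"
  proof (rule eq_initial)
    show "F' \<subseteq> Op" unfolding F'_def using s F by blast
    show "v < u" if "u \<in> Op - F'" "v \<in> F'" for u v
    proof -
      have "u \<noteq> v" using that by blast
      moreover have "\<not> u < v"
      proof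
        assume "u < v"
        have u: "u = x \<or> u \<in> Op - F \<and> u \<noteq> s" and v: "v = s \<or> v \<in> F \<and> v \<noteq> x"
          using that unfolding rest unfolding F'_def by blast+
        have "s \<le> u" if "u \<in> Op - F" using gap[OF s x \<open>s < x\<close>] that by blast
        moreover have "v \<le> x" if "v \<in> F" using gap[OF s x \<open>s < x\<close>] that by blast
        ultimately show False using u v only[of u v] \<open>u < v\<close> \<open>s < x\<close> by auto
      qed
      ultimately show ?thesis by simp
    qed
  qed (rule fin_Op)
  ultimately have F': "initial Op (card Cl) = F'" using F by simp
  have "Max F' = s"
  proof (rule Max_eqI)
    show "v \<le> s" if "v \<in> F'" for v
      using that only[OF s, of v] unfolding F'_def by fastforce
  qed (auto simp: F'_def fin)
  moreover have "Min (Op - F') = x"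
  proof (rule Min_eqI)
    show "x \<le> u" if "u \<in> Op - F'" for u
      using that only[OF _ x, of u] unfolding rest by fastforce
  qed (auto simp: rest fin_Op)
  ultimately show ?thesis
    unfolding swapped_def F' unfolding F'_def using s x by auto
qed

lemma admissible_initial_iff:
  "admissible n Op Cl (initial Op (card Cl)) Z \<longleftrightarrow>
     Z = {} \<and> even (int (card Op) - int (card Cl)) \<or>
     Z = {int n} \<and> odd (int (card Op) - int (card Cl)) \<and> int n \<in> Op \<inter> Cl"
proof -
  let ?F = "initial Op (card Cl)"
  have F: "?F \<subseteq> Op" "card ?F = card Cl"
    using card_initial[OF fin_Op card_le] by (auto simp: initial_def)
  have "\<not> s < x" if "s \<in> Op - ?F" "x \<in> ?F" for s x
    using initial_less[OF fin_Op that(2,1)] by simp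
  then show ?thesis
    unfolding admissible_def using F last_not_initial even_card_rest_iff[OF F] by auto
qed

text \<open>Since \<open>n\<close> is an opener outside the initial segment and the number of such openers is even, \<open>n\<close> is
  not the first of them. So \<open>n\<close> is not exchanged and stays outside the new set, as is necessary for a pair out of order.\<close>

lemma admissible_swapped:
  assumes even: "even (int (card Op) - int (card Cl))" and n: "int n \<in> Op \<inter> Cl"
  shows "admissible n Op Cl (swapped Op (card Cl)) {}"
    and "swapped Op (card Cl) \<noteq> initial Op (card Cl)"
proof -
  define F where "F = initial Op (card Cl)"
  define i where "i = Max F"
  define j where "j = Min (Op - F)"
  have F: "F \<subseteq> Op" "card F = card Cl"
    using card_initial[OF fin_Op card_le] by (auto simp: initial_def F_def)
  have less: "x < s" if "x \<in> F" "s \<in> Op - F" for x s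
    using initial_less[OF fin_Op] that unfolding F_def by blast
  have fin: "finite F" "finite (Op - F)" using F fin_Op finite_subset by auto
  have "F \<noteq> {}" using F(2) n fin_Cl by (metis IntD2 card_gt_0_iff empty_iff card.empty)
  then have i: "i \<in> F" "\<And>x. x \<in> F \<Longrightarrow> x \<le> i" unfolding i_def using fin by auto
  have n_rest: "int n \<in> Op - F" using n last_not_initial unfolding F_def by blast
  then have j: "j \<in> Op - F" "\<And>s. s \<in> Op - F \<Longrightarrow> j \<le> s"
    unfolding j_def using fin Min_in[OF fin(2)] by auto
  have "j \<noteq> int n"
  proof
    assume "j = int n"
    then have "Op - F = {int n}" using j Op n_rest by fastforce
    then have "card (Op - F) = 1" by simp
    then show False using even_card_rest_iff(1)[OF F] even by simp
  qed
  have sw: "swapped Op (card Cl) = insert j (F - {i})"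
    unfolding swapped_def F_def[symmetric] i_def[symmetric] j_def[symmetric] ..
  have sub: "insert j (F - {i}) \<subseteq> Op" using j F by blast
  have card: "card (insert j (F - {i})) = card Cl"
    using j(1) card_Suc_Diff1[OF fin(1) i(1)] fin(1) F(2) by simp
  have rest: "Op - insert j (F - {i}) = insert i (Op - F - {j})"
    using i j F by blast
  show "admissible n Op Cl (swapped Op (card Cl)) {}"
    unfolding sw admissible_def
  proof (intro conjI ballI impI)
    show "even (card (Op - insert j (F - {i}) - {}))"
      using even_card_rest_iff(1)[OF sub card] even by simp
    show "int n \<in> Op - insert j (F - {i})" using n_rest \<open>j \<noteq> int n\<close> by blast
    show "int n \<in> Cl" using n by blast
    fix s x assume s: "s \<in> Op - insert j (F - {i})" and x: "x \<in> insert j (F - {i})" and "s < x"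
    have sx: "s = i"
      using s x \<open>s < x\<close> less[of x s] j(2)[of s] unfolding rest by fastforce
    moreover have "x = j" using s x \<open>s < x\<close> i(2)[of x] sx by fastforce
    ultimately show "s \<le> t" if "t \<in> Op - insert j (F - {i})" for t
      using that less[OF i(1), of t] unfolding rest by fastforce
    show "t \<le> x" if "t \<in> insert j (F - {i})" for t
      using that less[OF _ j(1), of t] \<open>x = j\<close> by fastforce
  qed (use sub card in auto)
  show "swapped Op (card Cl) \<noteq> initial Op (card Cl)"
    unfolding sw F_def[symmetric] using j by blast
qed

lemma admissible_iff:
  "admissible n Op Cl F Z \<longleftrightarrow>
     F = initial Op (card Cl) \<and> Z = {} \<and> even (int (card Op) - int (card Cl)) \<or>
     F = initial Op (card Cl) \<and> Z = {int n} \<and> odd (int (card Op) - int (card Cl)) \<and>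
       int n \<in> Op \<inter> Cl \<or>
     F = swapped Op (card Cl) \<and> Z = {} \<and> even (int (card Op) - int (card Cl)) \<and> int n \<in> Op \<inter> Cl"
    (is "?L \<longleftrightarrow> ?R")
proof
  assume adm: ?L
  then have F: "F \<subseteq> Op" "card F = card Cl" unfolding admissible_def by blast+
  show ?R
  proof (cases "\<exists>s\<in>Op - F. \<exists>x\<in>F. s < x")
    case True
    then obtain s x where gap: "s \<in> Op - F" "x \<in> F" "s < x" by blast
    then have "Z = {}" "int n \<in> Op \<inter> Cl" using adm unfolding admissible_def by blast+
    moreover have "even (card (Op - F))"
      using adm \<open>Z = {}\<close> unfolding admissible_def by simp
    ultimately show ?thesis
      using admissible_gap_imp_swapped[OF adm gap] even_card_rest_iff(1)[OF F] by blast
  next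
    case False
    then have "x < s" if "s \<in> Op - F" "x \<in> F" for s x
      using that by (metis DiffD2 linorder_neqE)
    then have "F = initial Op (card F)" using F by (intro eq_initial[OF fin_Op])
    then have "F = initial Op (card Cl)" using F by simp
    then show ?thesis using adm admissible_initial_iff by blast
  qed
next
  assume ?R
  then show ?L using admissible_initial_iff admissible_swapped(1) by blast
qed

end

theorem proposition5p2:
  fixes n :: nat and Op Cl :: "int set"
  assumes "n \<ge> 1" and "opener_closer_config n Op Cl"
  shows "((\<exists>P. nonnesting_D n P \<and> openers P = Op \<and> closers P = Cl) \<longleftrightarrow>
            even (int (card Op) - int (card Cl)) \<or> int n \<in> Op \<inter> Cl) \<and>
         (even (int (card Op) - int (card Cl)) \<and> int n \<in> Op \<inter> Cl \<longrightarrow>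
            card {P. nonnesting_D n P \<and> openers P = Op \<and> closers P = Cl} = 2) \<and>
         (even (int (card Op) - int (card Cl)) \<noteq> (int n \<in> Op \<inter> Cl) \<longrightarrow>
            (\<exists>!P. nonnesting_D n P \<and> openers P = Op \<and> closers P = Cl))"
proof -
  have Op: "Op \<subseteq> {1..int n}" and Cl: "Cl \<subseteq> {1..int n}"
    and config: "\<And>k. k < n \<Longrightarrow> card (Cl \<inter> {1..int (k + 1)}) \<le> card (Op \<inter> {1..int k})"
    using assms(2) unfolding opener_closer_config_def by auto
  have "Cl \<inter> {1..int (n - 1 + 1)} = Cl" "Op \<inter> {1..int (n - 1)} = Op - {int n}"
    using assms(1) Op Cl by auto
  then have card_Cl: "card Cl \<le> card (Op - {int n})"
    using config[of "n - 1"] assms(1) by simp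
  have fin_Cl: "finite Cl" using finite_subset[OF Cl] by simp
  define Sols where "Sols = {P. nonnesting_D n P \<and> openers P = Op \<and> closers P = Cl}"
  define a where "a = arc_system Op Cl (initial Op (card Cl))"
  define b where "b = arc_system Op Cl (swapped Op (card Cl)) {}"
  let ?even = "even (int (card Op) - int (card Cl))" and ?n = "int n \<in> Op \<inter> Cl"
  define As where
    "As = {A. nonnesting_arcs n A \<and> {i \<in> Domain A. 0 < i} = Op \<and> {i \<in> Range A. 0 < i} = Cl}"
  have As: "As = {arc_system Op Cl F Z | F Z. admissible n Op Cl F Z}"
  proof (intro equalityI subsetI)
    fix A assume "A \<in> As"
    then show "A \<in> {arc_system Op Cl F Z | F Z. admissible n Op Cl F Z}"
      unfolding As_def using nonnesting_arcs_arc_system[of n A Op Cl] by blast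
  next
    fix A assume "A \<in> {arc_system Op Cl F Z | F Z. admissible n Op Cl F Z}"
    then obtain F Z where adm: "admissible n Op Cl F Z" and A: "A = arc_system Op Cl F Z" by blast
    show "A \<in> As"
      unfolding As_def A using arc_system_nonnesting_arcs[OF assms(2) adm] by simp
  qed
  note adm_iff = admissible_iff[OF Op card_Cl fin_Cl]
  have bij: "bij_betw arcs Sols As" unfolding Sols_def As_def by (rule bij_betw_arcs)
  have both: "As = {a {}, b}" if ?even ?n
    unfolding As adm_iff a_def b_def using that by blast
  have one: "As = {if ?even then a {} else a {int n}}" if "?even \<noteq> ?n"
    unfolding As adm_iff a_def b_def using that by auto
  have none: "As = {}" if "\<not> ?even" "\<not> ?n"
    unfolding As adm_iff using that by blast
  have "a {} \<noteq> b" if ?even ?n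
    using arc_system_inject[OF Op Cl, of "initial Op (card Cl)" "{}" "swapped Op (card Cl)" "{}"]
      admissible_swapped[OF Op card_Cl fin_Cl that] adm_iff that unfolding a_def b_def by blast
  then have card2: "card Sols = 2" if ?even ?n
    using that both bij_betw_same_card[OF bij] by simp
  have card1: "card Sols = 1" if "?even \<noteq> ?n"
    using one[OF that] bij_betw_same_card[OF bij] by simp
  have "Sols \<noteq> {} \<longleftrightarrow> As \<noteq> {}" using bij by (auto simp: bij_betw_def)
  then have "Sols \<noteq> {} \<longleftrightarrow> ?even \<or> ?n" using both one none by (cases ?even; cases ?n) auto
  moreover have "\<exists>!P. P \<in> Sols" if "?even \<noteq> ?n"
    using card1[OF that] by (auto simp: card_1_singleton_iff)
  ultimately show ?thesis using card2 unfolding Sols_def by auto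
qed

end
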